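(* Let $d\ge4$. Let $(V,\mathcal{B})$ be a $d$-partite hypergraph with a given $d$-partition $V_1,\ldots,V_d$, let $c\in\mathbb{R}_{\ge0}^V$ be vertex costs, let $n=|V|$, and let $x$ be a fractional vertex cover. There is a deterministic algorithm that computes an integral solution $\bar x\in\{0,1\}^V$ (a vertex cover) of cost $\sum_{v\in V}c_v\bar x_v\le\left(\frac d2-\frac{d}{128n}\right)\sum_{v\in V}c_vx_v$ in time $\mathcal{O}(n^3)$.
   Context: A hypergraph $(V,\mathcal{B})$ is $d$-partite if there is a partition $V=V_1\dot\cup\cdots\dot\cup V_d$ (a $d$-partition) with $|P\cap V_i|\le1$ for all $P\in\mathcal{B}$ and all $i$; the hypergraph need not be uniform. A fractional vertex cover is a vector $x\in\mathbb{R}_{\ge0}^V$ with $\sum_{v\in P}x_v\ge1$ for all $P\in\mathcal{B}$; an integral solution is $\bar x\in\{0,1\}^V$ with $\sum_{v\in P}\bar x_v\ge1$ for all $P\in\mathcal{B}$. The algorithm receives $V$, the $d$-partition, $c$ and $x$. *)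

theory Defs
  imports Complex_Main "HOL-Library.Landau_Symbols" "HOL-Library.Disjoint_Sets"
begin

subsection \<open>Hypergraphs, partitions and vertex covers\<close>

definition hypergraph :: "'a set \<Rightarrow> 'a set set \<Rightarrow> bool" where
  "hypergraph V B \<longleftrightarrow> finite V \<and> B \<subseteq> Pow V"

(* Individual parts may be empty, so d is not bounded by card V. *)
definition d_partition :: "'a set \<Rightarrow> 'a set set \<Rightarrow> nat \<Rightarrow> (nat \<Rightarrow> 'a set) \<Rightarrow> bool" where
  "d_partition V B d Vs \<longleftrightarrow>
     (\<Union>i\<in>{1..d}. Vs i) = V \<and> disjoint_family_on Vs {1..d} \<and>
     (\<forall>P\<in>B. \<forall>i\<in>{1..d}. card (P \<inter> Vs i) \<le> 1)"

(* Vectors indexed by V are functions whose values outside V are irrelevant. *)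
definition fractional_vertex_cover :: "'a set \<Rightarrow> 'a set set \<Rightarrow> ('a \<Rightarrow> real) \<Rightarrow> bool" where
  "fractional_vertex_cover V B x \<longleftrightarrow> (\<forall>v\<in>V. 0 \<le> x v) \<and> (\<forall>P\<in>B. (\<Sum>v\<in>P. x v) \<ge> 1)"

definition integral_vertex_cover :: "'a set \<Rightarrow> 'a set set \<Rightarrow> ('a \<Rightarrow> real) \<Rightarrow> bool" where
  "integral_vertex_cover V B xb \<longleftrightarrow> (\<forall>v\<in>V. xb v \<in> {0, 1}) \<and> (\<forall>P\<in>B. (\<Sum>v\<in>P. xb v) \<ge> 1)"

subsection \<open>A real random access machine\<close>

text \<open>
  Algorithms are programs of an imperative language with the operations of a unit-cost
  real RAM.  There are natural-number and real scalars and arrays; arrays are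
  unbounded and indexed by naturals.  Naturals support addition, truncated subtraction and
  comparison, reals support the four field operations and comparison.  There is a conversion from
  naturals to reals but none in the other direction (no rounding), and there are no real
  constants other than those computed from naturals, so that no information can be hidden
  in a constant.  Real division by zero returns zero, as in HOL.
\<close>

record state =
  nvar :: "string \<Rightarrow> nat"
  narr :: "string \<Rightarrow> nat \<Rightarrow> nat"
  rvar :: "string \<Rightarrow> real"
  rarr :: "string \<Rightarrow> nat \<Rightarrow> real"

datatype nexp =
    NConst nat
  | NVar string
  | NArr string nexp
  | NAdd nexp nexp
  | NSub nexp nexp

datatype rexp =
    RNat nexp
  | RVar string
  | RArr string nexp
  | RAdd rexp rexp
  | RSub rexp rexp
  | RMul rexp rexp
  | RDiv rexp rexp

datatype bexp =
    NLess nexp nexp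
  | NEq nexp nexp
  | RLess rexp rexp
  | REq rexp rexp
  | BNot bexp
  | BAnd bexp bexp

datatype com =
    Skip
  | NAssign string nexp
  | NStore string nexp nexp
  | RAssign string rexp
  | RStore string nexp rexp
  | Seq com com
  | Cond bexp com com
  | While bexp com

primrec nval :: "nexp \<Rightarrow> state \<Rightarrow> nat" where
  "nval (NConst k) s = k"
| "nval (NVar a) s = nvar s a"
| "nval (NArr a e) s = narr s a (nval e s)"
| "nval (NAdd e f) s = nval e s + nval f s"
| "nval (NSub e f) s = nval e s - nval f s"

primrec rval :: "rexp \<Rightarrow> state \<Rightarrow> real" where
  "rval (RNat e) s = real (nval e s)"
| "rval (RVar a) s = rvar s a"
| "rval (RArr a e) s = rarr s a (nval e s)"
| "rval (RAdd e f) s = rval e s + rval f s"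
| "rval (RSub e f) s = rval e s - rval f s"
| "rval (RMul e f) s = rval e s * rval f s"
| "rval (RDiv e f) s = rval e s / rval f s"

primrec bval :: "bexp \<Rightarrow> state \<Rightarrow> bool" where
  "bval (NLess e f) s = (nval e s < nval f s)"
| "bval (NEq e f) s = (nval e s = nval f s)"
| "bval (RLess e f) s = (rval e s < rval f s)"
| "bval (REq e f) s = (rval e s = rval f s)"
| "bval (BNot b) s = (\<not> bval b s)"
| "bval (BAnd b b') s = (bval b s \<and> bval b' s)"

text \<open>Evaluating an expression costs one time unit per node of its syntax tree.\<close>

primrec ntime :: "nexp \<Rightarrow> nat" where
  "ntime (NConst k) = 1"
| "ntime (NVar a) = 1"
| "ntime (NArr a e) = 1 + ntime e"
| "ntime (NAdd e f) = 1 + ntime e + ntime f"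
| "ntime (NSub e f) = 1 + ntime e + ntime f"

primrec rtime :: "rexp \<Rightarrow> nat" where
  "rtime (RNat e) = 1 + ntime e"
| "rtime (RVar a) = 1"
| "rtime (RArr a e) = 1 + ntime e"
| "rtime (RAdd e f) = 1 + rtime e + rtime f"
| "rtime (RSub e f) = 1 + rtime e + rtime f"
| "rtime (RMul e f) = 1 + rtime e + rtime f"
| "rtime (RDiv e f) = 1 + rtime e + rtime f"

primrec btime :: "bexp \<Rightarrow> nat" where
  "btime (NLess e f) = 1 + ntime e + ntime f"
| "btime (NEq e f) = 1 + ntime e + ntime f"
| "btime (RLess e f) = 1 + rtime e + rtime f"
| "btime (REq e f) = 1 + rtime e + rtime f"
| "btime (BNot b) = 1 + btime b"
| "btime (BAnd b b') = 1 + btime b + btime b'"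

text \<open>
  \<open>exec p s t s'\<close>: started in state \<open>s\<close>, the program \<open>p\<close>
  terminates in state \<open>s'\<close> after exactly \<open>t\<close> time units.
\<close>

inductive exec :: "com \<Rightarrow> state \<Rightarrow> nat \<Rightarrow> state \<Rightarrow> bool" where
  Skip: "exec Skip s 1 s"
| NAssign: "exec (NAssign a e) s (1 + ntime e) (s\<lparr>nvar := (nvar s)(a := nval e s)\<rparr>)"
| NStore: "exec (NStore a i e) s (1 + ntime i + ntime e)
             (s\<lparr>narr := (narr s)(a := (narr s a)(nval i s := nval e s))\<rparr>)"
| RAssign: "exec (RAssign a e) s (1 + rtime e) (s\<lparr>rvar := (rvar s)(a := rval e s)\<rparr>)"
| RStore: "exec (RStore a i e) s (1 + ntime i + rtime e)
             (s\<lparr>rarr := (rarr s)(a := (rarr s a)(nval i s := rval e s))\<rparr>)"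
| Seq: "exec p s t s' \<Longrightarrow> exec q s' t' s'' \<Longrightarrow> exec (Seq p q) s (t + t') s''"
| CondTrue: "bval b s \<Longrightarrow> exec p s t s' \<Longrightarrow> exec (Cond b p q) s (1 + btime b + t) s'"
| CondFalse: "\<not> bval b s \<Longrightarrow> exec q s t s' \<Longrightarrow> exec (Cond b p q) s (1 + btime b + t) s'"
| WhileFalse: "\<not> bval b s \<Longrightarrow> exec (While b p) s (1 + btime b) s"
| WhileTrue: "bval b s \<Longrightarrow> exec p s t s' \<Longrightarrow> exec (While b p) s' t' s'' \<Longrightarrow>
                exec (While b p) s (1 + btime b + t + t') s''"

inductive_cases SkipE: "exec Skip s t s'"
inductive_cases NAssignE: "exec (NAssign a e) s t s'"
inductive_cases NStoreE: "exec (NStore a i e) s t s'"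
inductive_cases RAssignE: "exec (RAssign a e) s t s'"
inductive_cases RStoreE: "exec (RStore a i e) s t s'"
inductive_cases SeqE: "exec (Seq p q) s t s'"
inductive_cases CondE: "exec (Cond b p q) s t s'"
inductive_cases WhileE: "exec (While b p) s t s'"

lemma exec_deterministic:
  "exec p s t s' \<Longrightarrow> exec p s u s'' \<Longrightarrow> t = u \<and> s' = s''"
proof (induction arbitrary: u s'' rule: exec.induct)
  case (Skip s) then show ?case by (cases rule: SkipE) auto
next
  case (NAssign a e s) then show ?case by (cases rule: NAssignE) auto
next
  case (NStore a i e s) then show ?case by (cases rule: NStoreE) auto
next
  case (RAssign a e s) then show ?case by (cases rule: RAssignE) auto
next
  case (RStore a i e s) then show ?case by (cases rule: RStoreE) auto
next
  case (Seq p s t s' q t' s1)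
  from Seq.prems obtain t1 s2 t2
    where "exec p s t1 s2" "exec q s2 t2 s''" "u = t1 + t2" by (rule SeqE)
  with Seq.IH show ?case by blast
next
  case (CondTrue b s p t s' q)
  from CondTrue.prems CondTrue.hyps(1) obtain t1
    where "exec p s t1 s''" "u = 1 + btime b + t1" by (auto elim: CondE)
  with CondTrue.IH show ?case by blast
next
  case (CondFalse b s q t s' p)
  from CondFalse.prems CondFalse.hyps(1) obtain t1
    where "exec q s t1 s''" "u = 1 + btime b + t1" by (auto elim: CondE)
  with CondFalse.IH show ?case by blast
next
  case (WhileFalse b s p)
  from WhileFalse.prems WhileFalse.hyps show ?case by (cases rule: WhileE) auto
next
  case (WhileTrue b s p t s' t' s1)
  from WhileTrue.prems WhileTrue.hyps(1) obtain t1 s2 t2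
    where "exec p s t1 s2" "exec (While b p) s2 t2 s''" "u = 1 + btime b + t1 + t2"
    by (cases rule: WhileE) auto
  with WhileTrue.IH show ?case by blast
qed

subsection \<open>Input and output\<close>

text \<open>
  The vertex set is presented as a list \<open>vs\<close> without repetitions; the \<open>i\<close>-th
  vertex is known to the machine as the index \<open>i\<close>.  The partition is presented by the
  index of the part of each vertex.  The edges are not part of the input.  Memory not
  holding input is zero.
\<close>

definition part_index :: "nat \<Rightarrow> (nat \<Rightarrow> 'a set) \<Rightarrow> 'a \<Rightarrow> nat" where
  "part_index d Vs v = (THE j. j \<in> {1..d} \<and> v \<in> Vs j)"

definition input_array :: "'a list \<Rightarrow> ('a \<Rightarrow> 'b::zero) \<Rightarrow> nat \<Rightarrow> 'b" where
  "input_array vs f i = (if i < length vs then f (vs ! i) else 0)"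

definition input_state ::
  "'a list \<Rightarrow> nat \<Rightarrow> (nat \<Rightarrow> 'a set) \<Rightarrow> ('a \<Rightarrow> real) \<Rightarrow> ('a \<Rightarrow> real) \<Rightarrow> state" where
  "input_state vs d Vs c x =
     \<lparr>nvar = (\<lambda>_. 0)(''n'' := length vs, ''d'' := d),
      narr = (\<lambda>_ _. 0)(''part'' := input_array vs (part_index d Vs)),
      rvar = (\<lambda>_. 0),
      rarr = (\<lambda>_ _. 0)(''c'' := input_array vs c, ''x'' := input_array vs x)\<rparr>"

definition output_vector :: "'a list \<Rightarrow> state \<Rightarrow> ('a \<Rightarrow> real) \<Rightarrow> bool" where
  "output_vector vs s xb \<longleftrightarrow> (\<forall>i<length vs. xb (vs ! i) = real (narr s ''xbar'' i))"

end

(*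
  Only the parts that contain vertices matter; let m be their number, D = max 4 m (so D <= d and
  D <= 4 n), alpha = D/2 - D/(128 n) and z = alpha x.  Each part gets a threshold, a function of
  one of two parameters u, v that is uniform when the parameter is uniform on [0,1), such
  that the thresholds of all D parts sum to D/2.  Selecting the vertices with z above the threshold
  of their part costs at most alpha * sum c x on average.  The selection is a vertex cover as
  soon as the largest unselected z-values of the parts sum to less than alpha.  This holds
  unless every such value is within D/(128 n) of its threshold.  A part with k vertices is
  that close with probability at most (k+1) D/(128 n), and there are two parts, one driven by u and
  one by v, with at most 8n/D vertices together; so the probabilities of the bad sets of u and
  of v add up to less than 1, and an averaging argument that avoids the product of the bad
  sets gives good parameters of low cost.  They can be rounded down to one of 6n+2 breakpoints,
  so that trying all pairs of breakpoints, in linear time each, takes time O(n^3).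
*)

theory Submission
  imports Defs "HOL-Analysis.Analysis" "HOL-Real_Asymp.Real_Asymp"
begin

section \<open>Thresholds with constant sum\<close>

text \<open>
  Labels are paired up as \<open>v, 1 - v\<close> and \<open>u, 1 - u\<close>.  For odd \<open>D\<close> the labels
  1, 2 and \<open>D\<close> instead use three uniform thresholds of sum \<open>3/2\<close>: \<open>v\<close>, the fractional
  part \<open>f\<close> of \<open>v + 1/2\<close>, and \<open>3/2 - v - f\<close>.
\<close>

definition threshold :: "nat \<Rightarrow> real \<Rightarrow> real \<Rightarrow> real" where
  "threshold r u v =
     (if r = 0 then 1 - u else if r = 1 then v else if r = 2 then 1 - v else if r = 3 then u
      else if r = 4 then (if v < 1/2 then v + 1/2 else v - 1/2)
      else (if v < 1/2 then 1 - 2 * v else 2 - 2 * v))"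

text \<open>
  The inequality is strict exactly for the increasing thresholds, which makes the selection
  right-continuous in \<open>u\<close> and \<open>v\<close>; hence it only changes at breakpoints.
\<close>

definition selected :: "nat \<Rightarrow> real \<Rightarrow> real \<Rightarrow> real \<Rightarrow> bool" where
  "selected r u v z \<longleftrightarrow>
     (if r \<in> {1, 3, 4} then threshold r u v < z else threshold r u v \<le> z)"

text \<open>Residues 1 and 2 form the complementary pair in \<open>v\<close>, residues 3 and 0 the
  pair in \<open>u\<close>. For odd D the last label has no partner; together with labels 1 and 2 it
  forms the triple of roles 1, 4, 5.\<close>

definition role :: "nat \<Rightarrow> nat \<Rightarrow> nat" where
  "role D j = (if odd D \<and> j = 2 then 4 else if odd D \<and> j = D then 5 else j mod 4)"

lemma threshold_nonneg:
  assumes "u \<in> {0..<1}" "v \<in> {0..<1}"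
  shows "0 \<le> threshold r u v"
  using assms by (auto simp: threshold_def)

lemma not_selected_le: "\<not> selected r u v z \<Longrightarrow> z \<le> threshold r u v"
  by (auto simp: selected_def split: if_splits)

lemma sum_threshold_mod_4: "(\<Sum>j=1..2*k. threshold (j mod 4) u v) = real k"
proof (induction k)
  case (Suc k)
  \<comment> \<open>Labels 2k+1 and 2k+2 are one complementary pair, in \<open>v\<close> for even k
    and in \<open>u\<close> for odd k.\<close>
  have "threshold (Suc (2*k) mod 4) u v + threshold (Suc (Suc (2*k)) mod 4) u v = 1"
  proof (cases "even k")
    case True
    then obtain l where "k = 2*l" by blast
    then have "Suc (2*k) mod 4 = 1" "Suc (Suc (2*k)) mod 4 = 2" by presburger+
    then show ?thesis by (simp add: threshold_def)
  next
    case False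
    then obtain l where "k = 2*l+1" by (blast elim: oddE)
    then have "Suc (2*k) mod 4 = 3" "Suc (Suc (2*k)) mod 4 = 0" by presburger+
    then show ?thesis by (simp add: threshold_def)
  qed
  then show ?case using Suc by simp
qed simp

lemma sum_threshold:
  assumes "4 \<le> D"
  shows "(\<Sum>j=1..D. threshold (role D j) u v) = real D / 2"
proof (cases "even D")
  case True
  then obtain k where "D = 2*k" by blast
  then show ?thesis using sum_threshold_mod_4[of u v k] True by (simp add: role_def)
next
  case False
  then obtain k where D: "D = 2*k+1" by (blast elim: oddE)
  let ?t = "\<lambda>j. threshold (role D j) u v"
  have "{1..D} = insert D (insert 2 ({1..2*k} - {2}))" using D assms by auto
  then have "sum ?t {1..D} = ?t D + (?t 2 + sum ?t ({1..2*k} - {2}))"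
    using D assms by (simp add: sum.insert del: insert_Diff_single)
  also have "sum ?t ({1..2*k} - {2}) = (\<Sum>j\<in>{1..2*k} - {2}. threshold (j mod 4) u v)"
    by (rule sum.cong) (auto simp: role_def D)
  also have "\<dots> = real k - threshold 2 u v"
    using sum_threshold_mod_4[of u v k] D assms by (subst sum_diff1) auto
  \<comment> \<open>Roles 4 and 5 contribute 3/2 - v in either branch, while the removed role 2
    contributed 1 - v; the net gain is the missing 1/2.\<close>
  also have "?t D + (?t 2 + (real k - threshold 2 u v)) = real D / 2"
    using D assms by (auto simp: role_def threshold_def field_simps)
  finally show ?thesis .
qed

text \<open>Each threshold is uniform on [0,1) in the one parameter that drives it, so a vertex of
  value z is selected with probability at most z. A finite union of closed intervals stands in for
  the exact set of parameters: it is visibly measurable, and only an upper bound is wanted.\<close>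

lemma selected_superset_exists:
  assumes "0 \<le> z"
  shows "\<exists>X. X \<in> sets lborel \<and> emeasure lborel X < \<infinity> \<and> measure lborel X \<le> z \<and>
    (\<forall>u\<in>{0..<1}. \<forall>v\<in>{0..<1}. selected r u v z \<longrightarrow> (if r \<in> {0, 3} then u else v) \<in> X)"
proof -
  consider "r = 0 \<or> r = 2" | "r = 1 \<or> r = 3" | "r = 4" | "r > 4" by linarith
  then show ?thesis
  proof cases
    case 1
    show ?thesis by (rule exI[of _ "{1-z..1}"])
        (use 1 assms in \<open>auto simp: selected_def threshold_def\<close>)
  next
    case 2
    show ?thesis by (rule exI[of _ "{0..z}"])
        (use 2 assms in \<open>auto simp: selected_def threshold_def\<close>)
  next
    case 3
    \<comment> \<open>One interval for each branch of the fractional part. The cap at 1 keeps the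
      total at z when z exceeds 1/2.\<close>
    let ?X = "{0..z-1/2} \<union> {1/2..min 1 (z+1/2)}"
    have "measure lborel ?X \<le> measure lborel {0..z-1/2} + measure lborel {1/2..min 1 (z+1/2)}"
      by (rule measure_Un_le) auto
    also have "\<dots> \<le> z" using assms by (auto simp: min_def max_def content_real_if)
    finally have le: "measure lborel ?X \<le> z" .
    have fin: "emeasure lborel ?X < \<infinity>"
      by (rule le_less_trans[OF emeasure_subadditive]) (auto simp: emeasure_lborel_Icc_eq)
    show ?thesis by (rule exI[of _ ?X])
        (use 3 le fin in \<open>auto simp: selected_def threshold_def split: if_splits\<close>)
  next
    case 4
    \<comment> \<open>On each half of [0,1) the threshold falls from 1 to 0 with slope -2, so each
      half contributes length z/2.\<close>
    let ?X = "{(1-z)/2..1/2} \<union> {1-z/2..1}"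
    have "measure lborel ?X \<le> measure lborel {(1-z)/2..1/2} + measure lborel {1-z/2..1}"
      by (rule measure_Un_le) auto
    also have "\<dots> \<le> z" using assms by (auto simp: field_simps content_real_if)
    finally have le: "measure lborel ?X \<le> z" .
    have fin: "emeasure lborel ?X < \<infinity>"
      by (rule le_less_trans[OF emeasure_subadditive]) (auto simp: emeasure_lborel_Icc_eq)
    show ?thesis by (rule exI[of _ ?X])
        (use 4 le fin in \<open>auto simp: selected_def threshold_def field_simps split: if_splits\<close>)
  qed
qed

section \<open>Averaging\<close>

text \<open>The function equal to a on [0,1) and 0 elsewhere, minus e times the indicator of W, is a
  minorant of f on the whole line: outside [0,1) it is at most 0. Hence W and the support of f may
  stick out of the unit interval.\<close>

lemma integral_lower_bound:
  fixes f :: "real \<Rightarrow> real"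
  assumes f: "integrable lborel f" "\<And>u. 0 \<le> f u"
    and W: "W \<in> sets lborel" "emeasure lborel W < \<infinity>"
    and e: "0 \<le> e" and le: "\<And>u. u \<in> {0..<1} \<Longrightarrow> a - e * indicator W u \<le> f u"
  shows "a - e * measure lborel W \<le> integral\<^sup>L lborel f"
proof -
  have iW: "integrable lborel (indicator W :: real \<Rightarrow> real)"
    using W by (intro integrable_real_indicator) auto
  have i1: "integrable lborel (indicator {0..<1} :: real \<Rightarrow> real)"
    by (intro integrable_real_indicator) auto
  have "integral\<^sup>L lborel (\<lambda>u. a * indicator {0..<1} u - e * indicator W u) \<le> integral\<^sup>L lborel f"
  proof (rule integral_mono)
    show "a * indicator {0..<1} u - e * indicator W u \<le> f u" for u :: real
    proof (cases "u \<in> {0..<1}")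
      case False
      then show ?thesis using f(2)[of u] e by (auto simp: indicator_def)
    qed (use le[of u] in auto)
  qed (use iW i1 f in auto)
  also have "integral\<^sup>L lborel (\<lambda>u. a * indicator {0..<1} u - e * indicator W u)
      = a - e * measure lborel W"
    using iW i1 W by (subst Bochner_Integration.integral_diff) auto
  finally show ?thesis .
qed

text \<open>
  If every admissible pair were too expensive by comparison with the minima of \<open>f\<close> and
  \<open>g\<close> off the bad sets, then on the bad sets each function would exceed its minimum minus
  the excess \<open>e\<close>, and integrating would give a contradiction.
\<close>

lemma averaging_off_bad_rectangle:
  fixes f g :: "real \<Rightarrow> real"
  assumes f: "integrable lborel f" "\<And>u. 0 \<le> f u" "finite (range f)"
    and g: "integrable lborel g" "\<And>u. 0 \<le> g u" "finite (range g)"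
    and W: "W \<in> sets lborel" "emeasure lborel W < \<infinity>"
    and W': "W' \<in> sets lborel" "emeasure lborel W' < \<infinity>"
    and small: "measure lborel W + measure lborel W' < 1"
  shows "\<exists>u\<in>{0..<1}. \<exists>v\<in>{0..<1}. (u \<notin> W \<or> v \<notin> W') \<and>
     f u + g v \<le> integral\<^sup>L lborel f + integral\<^sup>L lborel g"
proof (rule ccontr)
  define K where "K = integral\<^sup>L lborel f + integral\<^sup>L lborel g"
  assume "\<not> ?thesis"
  then have large: "K < f u + g v"
    if "u \<in> {0..<1}" "v \<in> {0..<1}" "u \<notin> W \<or> v \<notin> W'" for u v
    using that unfolding K_def by (meson not_le)
  have minimizer: "\<exists>u\<in>{0..<1} - U. \<forall>u'\<in>{0..<1} - U. h u \<le> h u'"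
    if "finite (range h)" "U \<in> sets lborel" "emeasure lborel U < \<infinity>" "measure lborel U < 1"
    for h :: "real \<Rightarrow> real" and U
  proof -
    have "{0..<1} - U \<noteq> {}"
    proof
      assume "{0..<1} - U = {}"
      then have "measure lborel {0..<1::real} \<le> measure lborel U"
        using that by (intro measure_mono_fmeasurable) (auto simp: fmeasurable_def)
      then show False using that by simp
    qed
    moreover have "finite (h ` ({0..<1} - U))"
      using that(1) by (rule finite_subset[rotated]) auto
    ultimately have "Min (h ` ({0..<1} - U)) \<in> h ` ({0..<1} - U)"
      "\<forall>u'\<in>{0..<1} - U. Min (h ` ({0..<1} - U)) \<le> h u'" by auto
    then show ?thesis by (metis (no_types, lifting) imageE)
  qed
  have "0 \<le> measure lborel W" "0 \<le> measure lborel W'" by auto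
  then have lt: "measure lborel W < 1" "measure lborel W' < 1" using small by linarith+
  obtain u where u: "u \<in> {0..<1} - W" "\<And>u'. u' \<in> {0..<1} - W \<Longrightarrow> f u \<le> f u'"
    using minimizer[OF f(3) W lt(1)] by blast
  obtain v where v: "v \<in> {0..<1} - W'" "\<And>v'. v' \<in> {0..<1} - W' \<Longrightarrow> g v \<le> g v'"
    using minimizer[OF g(3) W' lt(2)] by blast
  define e where "e = f u + g v - K"
  have e: "0 < e" using large[of u v] u v by (auto simp: e_def)
  have "f u - e * measure lborel W \<le> integral\<^sup>L lborel f"
  proof (rule integral_lower_bound[OF f(1,2) W])
    fix u' :: real assume "u' \<in> {0..<1}"
    \<comment> \<open>For u' in W the pair (u', v) is still admissible because v avoids W', so f u'
      > K - g v = f u - e.\<close>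
    then show "f u - e * indicator W u' \<le> f u'"
      using u(2)[of u'] large[of u' v] v(1) by (cases "u' \<in> W") (auto simp: e_def)
  qed (use e in auto)
  moreover have "g v - e * measure lborel W' \<le> integral\<^sup>L lborel g"
  proof (rule integral_lower_bound[OF g(1,2) W'])
    fix v' :: real assume "v' \<in> {0..<1}"
    then show "g v - e * indicator W' v' \<le> g v'"
      using v(2)[of v'] large[of u v'] u(1) by (cases "v' \<in> W'") (auto simp: e_def)
  qed (use e in auto)
  ultimately have "f u + g v - e * (measure lborel W + measure lborel W') \<le> K"
    by (simp add: K_def algebra_simps)
  moreover have "e * (measure lborel W + measure lborel W') < e * 1"
    using e small by (intro mult_strict_left_mono) auto
  ultimately show False by (simp add: e_def)
qed

section \<open>Cheap parameters\<close>

text \<open>The largest unselected value with label j among the first i vertices, or 0 if there is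
  none. The recursion follows the vertex scan of the program.\<close>

primrec height :: "(nat \<Rightarrow> bool) \<Rightarrow> (nat \<Rightarrow> real) \<Rightarrow> (nat \<Rightarrow> nat) \<Rightarrow> nat \<Rightarrow> nat \<Rightarrow> real" where
  "height S z q 0 j = 0"
| "height S z q (Suc i) j =
     (if q i = j \<and> \<not> S i then max (height S z q i j) (z i) else height S z q i j)"

lemma height_nonneg: "0 \<le> height S z q i j"
  by (induction i) auto

lemma height_ge: "k < i \<Longrightarrow> \<not> S k \<Longrightarrow> z k \<le> height S z q i (q k)"
  by (induction i) (auto simp: less_Suc_eq)

lemma height_cases:
  "height S z q i j = 0 \<or> (\<exists>k<i. q k = j \<and> \<not> S k \<and> height S z q i j = z k)"
  by (induction i) (auto simp: max_def less_Suc_eq)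

lemma height_cong:
  "(\<And>k. k < i \<Longrightarrow> S k = S' k) \<Longrightarrow> height S z q i j = height S' z q i j"
  by (induction i) auto

definition chosen :: "nat \<Rightarrow> (nat \<Rightarrow> nat) \<Rightarrow> (nat \<Rightarrow> real) \<Rightarrow> real \<Rightarrow> real \<Rightarrow> nat \<Rightarrow> bool" where
  "chosen D q z u v i \<longleftrightarrow> selected (role D (q i)) u v (z i)"

definition total_height :: "nat \<Rightarrow> nat \<Rightarrow> (nat \<Rightarrow> nat) \<Rightarrow> (nat \<Rightarrow> real) \<Rightarrow> real \<Rightarrow> real \<Rightarrow> real" where
  "total_height n D q z u v = (\<Sum>j\<in>q ` {..<n}. height (chosen D q z u v) z q n j)"

definition choice_cost ::
  "nat \<Rightarrow> nat \<Rightarrow> (nat \<Rightarrow> nat) \<Rightarrow> (nat \<Rightarrow> real) \<Rightarrow> (nat \<Rightarrow> real) \<Rightarrow> real \<Rightarrow> real \<Rightarrow> real" where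
  "choice_cost n D q c z u v = (\<Sum>i<n. if chosen D q z u v i then c i else 0)"

text \<open>
  The parameters for which a part with threshold \<open>u\<close> or \<open>v\<close> wastes at most \<open>\<sigma>\<close>
  between its threshold and its largest unselected value; 0 stands for a part without
  unselected vertices.
\<close>

definition near :: "nat \<Rightarrow> (nat \<Rightarrow> nat) \<Rightarrow> (nat \<Rightarrow> real) \<Rightarrow> real \<Rightarrow> nat \<Rightarrow> real set" where
  "near n q z \<sigma> l = (\<Union>y\<in>insert 0 (z ` {i. i < n \<and> q i = l}). {y..y+\<sigma>})"

lemma near_props:
  assumes "0 \<le> \<sigma>"
  shows "near n q z \<sigma> l \<in> sets lborel" "emeasure lborel (near n q z \<sigma> l) < \<infinity>"
    "measure lborel (near n q z \<sigma> l) \<le> (real (card {i. i < n \<and> q i = l}) + 1) * \<sigma>"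
proof -
  let ?Y = "insert 0 (z ` {i. i < n \<and> q i = l})"
  have fin: "finite ?Y" by simp
  show "near n q z \<sigma> l \<in> sets lborel" unfolding near_def by auto
  have "bounded (near n q z \<sigma> l)" unfolding near_def by (intro bounded_UN) auto
  then show "emeasure lborel (near n q z \<sigma> l) < \<infinity>" by (rule emeasure_bounded_finite)
  have "measure lborel (near n q z \<sigma> l) \<le> (\<Sum>y\<in>?Y. measure lborel {y..y+\<sigma>})"
    unfolding near_def by (rule measure_UNION_le[OF fin]) auto
  also have "\<dots> = real (card ?Y) * \<sigma>" using assms by simp
  also have "card ?Y \<le> Suc (card (z ` {i. i < n \<and> q i = l}))" by (rule card_insert_le_m1) auto
  then have "real (card ?Y) * \<sigma> \<le> (real (card {i. i < n \<and> q i = l}) + 1) * \<sigma>"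
    using card_image_le[of "{i. i < n \<and> q i = l}" z] assms by (intro mult_right_mono) auto
  finally show "measure lborel (near n q z \<sigma> l) \<le> (real (card {i. i < n \<and> q i = l}) + 1) * \<sigma>" .
qed

text \<open>No height exceeds the threshold of its part, and the thresholds sum to D/2. The
  threshold w of label l lies outside [y, y + \<sigma>] for y the height of l, so this single part
  wastes more than \<sigma>.\<close>

lemma total_height_less:
  assumes D: "4 \<le> D" and q: "q ` {..<n} \<subseteq> {1..D}"
    and uv: "u \<in> {0..<1}" "v \<in> {0..<1}"
    and l: "l \<in> {1..D}" "role D l = 1 \<and> w = v \<or> role D l = 3 \<and> w = u"
    and far: "w \<notin> near n q z \<sigma> l"
  shows "total_height n D q z u v < real D / 2 - \<sigma>"
proof -
  let ?h = "height (chosen D q z u v) z q n"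
  have le: "?h j \<le> threshold (role D j) u v" for j
    using height_cases[of "chosen D q z u v" z q n j] threshold_nonneg[OF uv]
      not_selected_le[of "role D j" u v] by (auto simp: chosen_def)
  have thr: "threshold (role D l) u v = w" using l(2) by (auto simp: threshold_def)
  have w: "0 \<le> w" using l(2) uv by auto
  have lt: "?h l < w - \<sigma>"
    using height_cases[of "chosen D q z u v" z q n l]
  proof
    assume "?h l = 0"
    then show ?thesis using far w by (force simp: near_def)
  next
    assume "\<exists>k<n. q k = l \<and> \<not> chosen D q z u v k \<and> ?h l = z k"
    then obtain k where k: "k < n" "q k = l" "?h l = z k" by blast
    then have "z k \<le> w" using le[of l] thr by simp
    then show ?thesis using far k by (auto simp: near_def)
  qed
  have "total_height n D q z u v \<le> sum ?h {1..D}"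
    unfolding total_height_def using q by (intro sum_mono2) (auto simp: height_nonneg)
  also have "\<dots> = ?h l + sum ?h ({1..D} - {l})" using l(1) by (simp add: sum.remove)
  also have "\<dots> < (w - \<sigma>) + (\<Sum>j\<in>{1..D} - {l}. threshold (role D j) u v)"
    using lt le by (intro add_less_le_mono sum_mono) auto
  also have "\<dots> = (\<Sum>j=1..D. threshold (role D j) u v) - \<sigma>"
    using l(1) thr by (subst (2) sum.remove[of _ l]) auto
  finally show ?thesis using sum_threshold[OF D, of u v] by linarith
qed

text \<open>Pigeonhole over the disjoint label pairs 4r+1, 4r+3 for r < D div 4: the lightest pair
  carries at most the average number of vertices.\<close>

lemma light_labels_exist:
  assumes D: "4 \<le> D"
  shows "\<exists>l l'. l \<in> {1..D} \<and> l' \<in> {1..D} \<and> role D l = 1 \<and> role D l' = 3 \<and>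
    D * (card {i. i < n \<and> q i = l} + card {i. i < n \<and> q i = l'}) \<le> 8 * n"
proof -
  define M where "M = D div 4"
  define A where "A l = {i. i < n \<and> q i = l}" for l
  define B where "B r = A (4*r+1) \<union> A (4*r+3)" for r
  \<comment> \<open>D < 4M + 4 together with M \<ge> 1 gives D \<le> 8M; this is where the factor 8
    comes from.\<close>
  have M: "0 < M" "4 * M \<le> D" "D \<le> 8 * M" using D unfolding M_def by presburger+
  have finA: "finite (A l)" for l by (simp add: A_def)
  have disj: "disjoint_family_on B {..<M}"
    unfolding disjoint_family_on_def B_def A_def by auto
  have "(\<Sum>r<M. card (B r)) = card (\<Union>r<M. B r)"
    using disj finA by (subst card_UN_disjoint') (auto simp: B_def)
  also have "\<dots> \<le> card {..<n}" by (rule card_mono) (auto simp: B_def A_def)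
  finally have sum: "(\<Sum>r<M. card (B r)) \<le> n" by simp
  obtain r where r: "r < M" "M * card (B r) \<le> n"
  proof (rule ccontr)
    assume "\<not> thesis"
    then have "\<And>r. r < M \<Longrightarrow> n < M * card (B r)" using that by (meson not_le)
    then have "(\<Sum>r<M. n) < (\<Sum>r<M. M * card (B r))" using M by (intro sum_strict_mono) auto
    then show False using sum by (simp add: sum_distrib_left[symmetric])
  qed
  have "card (B r) = card (A (4*r+1)) + card (A (4*r+3))"
    unfolding B_def by (rule card_Un_disjoint) (auto simp: finA A_def)
  then have "D * (card (A (4*r+1)) + card (A (4*r+3))) \<le> 8 * (M * card (B r))"
    using M(3) mult_le_mono1[of D "8*M" "card (B r)"] by simp
  also have "\<dots> \<le> 8 * n" using r by simp
  finally have "D * (card (A (4*r+1)) + card (A (4*r+3))) \<le> 8 * n" .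
  moreover have "4*r+1 \<in> {1..D}" "4*r+3 \<in> {1..D}" using r(1) M(2) by auto
  \<comment> \<open>Both labels are odd and below D, so the exceptions of \<open>role\<close> for
    labels 2 and D do not apply.\<close>
  moreover have "4*r+3 < D" using r(1) M(2) by linarith
  then have "role D (4*r+1) = 1" "role D (4*r+3) = 3" unfolding role_def by presburger+
  ultimately show ?thesis unfolding A_def by blast
qed

text \<open>The cost is bounded by a function of \<open>u\<close> plus a function of
  \<open>v\<close>, so \<open>averaging_off_bad_rectangle\<close> applies. Escaping one of the two
  bad sets is enough, because \<open>total_height_less\<close> needs just one wasteful part.\<close>

lemma cheap_parameters_exist:
  assumes D: "4 \<le> D" "D \<le> 4 * n" and q: "q ` {..<n} \<subseteq> {1..D}"
    and z: "\<And>i. i < n \<Longrightarrow> 0 \<le> z i" and c: "\<And>i. i < n \<Longrightarrow> 0 \<le> c i"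
  shows "\<exists>u\<in>{0..<1}. \<exists>v\<in>{0..<1}.
    total_height n D q z u v < real D / 2 - real D / (128 * real n) \<and>
    choice_cost n D q c z u v \<le> (\<Sum>i<n. c i * z i)"
proof -
  define \<sigma> where "\<sigma> = real D / (128 * real n)"
  have n: "0 < n" using D by simp
  have \<sigma>: "0 \<le> \<sigma>" by (simp add: \<sigma>_def)
  obtain l l' where l: "l \<in> {1..D}" "l' \<in> {1..D}" "role D l = 1" "role D l' = 3"
    and card: "D * (card {i. i < n \<and> q i = l} + card {i. i < n \<and> q i = l'}) \<le> 8 * n"
      (is "D * (?k + ?k') \<le> _")
    using light_labels_exist[OF D(1)] by blast
  \<comment> \<open>Label \<open>l\<close> has threshold \<open>v\<close> and label
    \<open>l'\<close> has threshold \<open>u\<close>, so \<open>?W'\<close> is the bad set for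
    \<open>v\<close> and \<open>?W\<close> the one for \<open>u\<close>.\<close>
  let ?W' = "near n q z \<sigma> l" and ?W = "near n q z \<sigma> l'"
  have "real D * (real ?k + real ?k') \<le> 8 * real n"
    using card by (metis of_nat_add of_nat_le_iff of_nat_mult of_nat_numeral)
  moreover have "real D \<le> 4 * real n" using D(2) by linarith
  \<comment> \<open>The left side is at most 8n + 8n, so the constant 128 leaves ample room.\<close>
  ultimately have "real D * (real ?k + real ?k') + 2 * real D < 128 * real n" using n by simp
  moreover have "(real ?k + 1) * \<sigma> + (real ?k' + 1) * \<sigma>
      = (real D * (real ?k + real ?k') + 2 * real D) / (128 * real n)"
    by (simp add: \<sigma>_def add_divide_distrib algebra_simps)
  ultimately have "(real ?k + 1) * \<sigma> + (real ?k' + 1) * \<sigma> < 1" using n by simp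
  then have small: "measure lborel ?W + measure lborel ?W' < 1"
    using near_props(3)[OF \<sigma>, of n q z l] near_props(3)[OF \<sigma>, of n q z l'] by linarith
  define r where "r i = role D (q i)" for i
  define P where "P i Y \<longleftrightarrow> Y \<in> sets lborel \<and> emeasure lborel Y < \<infinity> \<and> measure lborel Y \<le> z i \<and>
    (\<forall>u\<in>{0..<1}. \<forall>v\<in>{0..<1}. selected (r i) u v (z i) \<longrightarrow>
       (if r i \<in> {0, 3} then u else v) \<in> Y)" for i Y
  have "\<exists>Y. P i Y" if "i < n" for i
    unfolding P_def by (rule selected_superset_exists[OF z[OF that]])
  then obtain X where "\<And>i. i < n \<Longrightarrow> P i (X i)" by metis
  note X = this[unfolded P_def]
  \<comment> \<open>\<open>F I\<close> bounds the cost of the selected vertices of \<open>I\<close>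
    as a function of the parameter that drives them.\<close>
  define F where "F I w = (\<Sum>i\<in>I. c i * indicator (X i) w)" for I and w :: real
  have F: "integrable lborel (F I)" "integral\<^sup>L lborel (F I) \<le> (\<Sum>i\<in>I. c i * z i)"
    "\<And>w. 0 \<le> F I w" "finite (range (F I))" if I: "I \<subseteq> {..<n}" for I
  proof -
    have finI: "finite I" using I finite_subset by blast
    have int: "integrable lborel (\<lambda>w. c i * indicator (X i) w :: real)" if "i \<in> I" for i
      using X[of i] that I by (intro integrable_mult_right integrable_real_indicator) auto
    then show "integrable lborel (F I)" unfolding F_def by auto
    have "integral\<^sup>L lborel (F I) = (\<Sum>i\<in>I. c i * measure lborel (X i))"
      unfolding F_def using int by (subst Bochner_Integration.integral_sum) auto
    also have "\<dots> \<le> (\<Sum>i\<in>I. c i * z i)"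
      using X c I by (intro sum_mono mult_left_mono) auto
    finally show "integral\<^sup>L lborel (F I) \<le> (\<Sum>i\<in>I. c i * z i)" .
    show "0 \<le> F I w" for w unfolding F_def using c I by (intro sum_nonneg) auto
    \<comment> \<open>All values are subset sums of the costs; finiteness of the range is what
      provides minimizers in the averaging argument.\<close>
    have "F I w = sum c {i\<in>I. w \<in> X i}" for w
      unfolding F_def sum.inter_filter[OF finI] by (intro sum.cong) (auto simp: indicator_def)
    then have "range (F I) \<subseteq> sum c ` Pow I" by auto
    then show "finite (range (F I))" using finI finite_subset by blast
  qed
  \<comment> \<open>\<open>I\<close> collects the vertices driven by \<open>u\<close>,
    \<open>J\<close> those driven by \<open>v\<close>.\<close>
  define I J where "I = {i. i < n \<and> r i \<in> {0, 3}}" and "J = {i. i < n \<and> r i \<notin> {0, 3}}"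
  have IJ: "I \<subseteq> {..<n}" "J \<subseteq> {..<n}" "I \<inter> J = {}" "I \<union> J = {..<n}"
    unfolding I_def J_def by auto
  then have split: "sum f {..<n} = sum f I + sum f J" for f :: "nat \<Rightarrow> real"
    by (metis finite_lessThan finite_subset sum.union_disjoint)
  obtain u v where uv: "u \<in> {0..<1}" "v \<in> {0..<1}" "u \<notin> ?W \<or> v \<notin> ?W'"
    and le: "F I u + F J v \<le> integral\<^sup>L lborel (F I) + integral\<^sup>L lborel (F J)"
    using averaging_off_bad_rectangle[OF F(1,3,4)[OF IJ(1)] F(1,3,4)[OF IJ(2)]
        near_props(1,2)[OF \<sigma>] near_props(1,2)[OF \<sigma>] small] by blast
  have "total_height n D q z u v < real D / 2 - \<sigma>"
    using uv(3) total_height_less[OF D(1) q uv(1,2) l(1), of v] l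
      total_height_less[OF D(1) q uv(1,2) l(2), of u] by blast
  moreover have in_X: "(if r i \<in> {0, 3} then u else v) \<in> X i"
    if "i < n" "chosen D q z u v i" for i
    using X[OF that(1)] that(2) uv(1,2) by (simp add: chosen_def r_def[symmetric])
  have "choice_cost n D q c z u v \<le> F I u + F J v"
    unfolding choice_cost_def split F_def
  proof (intro add_mono sum_mono)
    show "(if chosen D q z u v i then c i else 0) \<le> c i * indicator (X i) u" if "i \<in> I" for i
      using in_X[of i] c[of i] that by (auto simp: I_def indicator_def)
    show "(if chosen D q z u v i then c i else 0) \<le> c i * indicator (X i) v" if "i \<in> J" for i
      using in_X[of i] c[of i] that by (auto simp: J_def indicator_def)
  qed
  ultimately show ?thesis
    using uv le F(2)[OF IJ(1)] F(2)[OF IJ(2)] split[of "\<lambda>i. c i * z i"]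
    unfolding \<sigma>_def by (intro bexI[of _ u] bexI[of _ v] conjI) auto
qed

section \<open>Rounding the parameters to finitely many candidates\<close>

definition breakpoints :: "real \<Rightarrow> real set" where
  "breakpoints z = {z, 1 - z, z - 1/2, z + 1/2, (1 - z) / 2, 1 - z / 2}"

text \<open>The breakpoints of z are the parameters at which some threshold meets z. Rounding down
  to an element of C keeps the truth of y \<le> u for every y in C, and selection depends on such
  comparisons only; 1/2 is included for the case split of roles 4 and 5.\<close>

lemma selected_at_breakpoint:
  assumes C: "{0, 1/2} \<union> breakpoints z \<subseteq> C"
    and u: "u0 \<le> u" "\<And>y. y \<in> C \<Longrightarrow> y \<le> u \<Longrightarrow> y \<le> u0"
    and v: "v0 \<le> v" "\<And>y. y \<in> C \<Longrightarrow> y \<le> v \<Longrightarrow> y \<le> v0"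
  shows "selected r u0 v0 z = selected r u v z"
proof -
  have iff: "y \<le> u0 \<longleftrightarrow> y \<le> u" "y \<le> v0 \<longleftrightarrow> y \<le> v" if "y \<in> {0, 1/2} \<union> breakpoints z" for y
    using that u v C by force+
  have "z \<le> u0 \<longleftrightarrow> z \<le> u" "1 - z \<le> u0 \<longleftrightarrow> 1 - z \<le> u" "z \<le> v0 \<longleftrightarrow> z \<le> v" "1/2 \<le> v0 \<longleftrightarrow> 1/2 \<le> v"
    "1 - z \<le> v0 \<longleftrightarrow> 1 - z \<le> v" "z - 1/2 \<le> v0 \<longleftrightarrow> z - 1/2 \<le> v" "z + 1/2 \<le> v0 \<longleftrightarrow> z + 1/2 \<le> v"
    "(1-z)/2 \<le> v0 \<longleftrightarrow> (1-z)/2 \<le> v" "1-z/2 \<le> v0 \<longleftrightarrow> 1-z/2 \<le> v"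
    by (rule iff; simp add: breakpoints_def)+
  \<comment> \<open>The strictness convention of \<open>selected\<close> makes every test a
    comparison of this one form, negated where the threshold increases.\<close>
  moreover have "selected r u v z = (if r = 0 then 1 - z \<le> u else if r = 1 then \<not> z \<le> v
      else if r = 2 then 1 - z \<le> v else if r = 3 then \<not> z \<le> u
      else if r = 4 then (if 1/2 \<le> v then \<not> z + 1/2 \<le> v else \<not> z - 1/2 \<le> v)
      else (if 1/2 \<le> v then 1 - z/2 \<le> v else (1-z)/2 \<le> v))" for u v
    by (auto simp: selected_def threshold_def field_simps)
  ultimately show ?thesis by (simp only:)
qed

lemma cheap_breakpoints_exist:
  assumes D: "4 \<le> D" "D \<le> 4 * n" and q: "q ` {..<n} \<subseteq> {1..D}"
    and z: "\<And>i. i < n \<Longrightarrow> 0 \<le> z i" and c: "\<And>i. i < n \<Longrightarrow> 0 \<le> c i"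
    and C: "finite C" "{0, 1/2} \<union> (\<Union>i<n. breakpoints (z i)) \<subseteq> C"
  shows "\<exists>u\<in>C. \<exists>v\<in>C. total_height n D q z u v < real D / 2 - real D / (128 * real n) \<and>
    choice_cost n D q c z u v \<le> (\<Sum>i<n. c i * z i)"
proof -
  have round: "\<exists>w0\<in>C. w0 \<le> w \<and> (\<forall>y\<in>C. y \<le> w \<longrightarrow> y \<le> w0)" if "w \<in> {0..<1}" for w
  proof -
    define Y where "Y = {y\<in>C. y \<le> w}"
    \<comment> \<open>The candidate 0 guarantees that there is something to round down to.\<close>
    have "finite Y" "0 \<in> Y" using C that by (auto simp: Y_def)
    then have "Max Y \<in> Y" "\<forall>y\<in>Y. y \<le> Max Y" by (auto intro: Max_in)
    then show ?thesis unfolding Y_def by blast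
  qed
  obtain u v where uv: "u \<in> {0..<1}" "v \<in> {0..<1}"
    and good: "total_height n D q z u v < real D / 2 - real D / (128 * real n)"
      "choice_cost n D q c z u v \<le> (\<Sum>i<n. c i * z i)"
    using cheap_parameters_exist[where z = z and c = c, OF D q z c] by blast
  obtain u0 where u0: "u0 \<in> C" "u0 \<le> u" "\<And>y. y \<in> C \<Longrightarrow> y \<le> u \<Longrightarrow> y \<le> u0"
    using round[OF uv(1)] by blast
  obtain v0 where v0: "v0 \<in> C" "v0 \<le> v" "\<And>y. y \<in> C \<Longrightarrow> y \<le> v \<Longrightarrow> y \<le> v0"
    using round[OF uv(2)] by blast
  have same: "chosen D q z u0 v0 i = chosen D q z u v i" if "i < n" for i
    unfolding chosen_def using C(2) that by (intro selected_at_breakpoint[OF _ u0(2,3) v0(2,3)]) auto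
  have "total_height n D q z u0 v0 = total_height n D q z u v"
    unfolding total_height_def using same by (intro sum.cong height_cong) auto
  moreover have "choice_cost n D q c z u0 v0 = choice_cost n D q c z u v"
    unfolding choice_cost_def using same by (intro sum.cong) auto
  ultimately show ?thesis using good u0(1) v0(1) by metis
qed

section \<open>Total correctness with running time\<close>

text \<open>One terminating run is enough for total correctness, since
  \<open>exec_deterministic\<close> makes it the only run. The postcondition also sees the exact
  running time.\<close>

definition wpt :: "com \<Rightarrow> state \<Rightarrow> (nat \<Rightarrow> state \<Rightarrow> bool) \<Rightarrow> bool" where
  "wpt p s Q \<longleftrightarrow> (\<exists>t s'. exec p s t s' \<and> Q t s')"

lemma wpt_simps [simp]:
  "wpt Skip s Q = Q 1 s"
  "wpt (NAssign a e) s Q = Q (1 + ntime e) (s\<lparr>nvar := (nvar s)(a := nval e s)\<rparr>)"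
  "wpt (NStore a i e) s Q = Q (1 + ntime i + ntime e)
     (s\<lparr>narr := (narr s)(a := (narr s a)(nval i s := nval e s))\<rparr>)"
  "wpt (RAssign a r) s Q = Q (1 + rtime r) (s\<lparr>rvar := (rvar s)(a := rval r s)\<rparr>)"
  "wpt (RStore a i r) s Q = Q (1 + ntime i + rtime r)
     (s\<lparr>rarr := (rarr s)(a := (rarr s a)(nval i s := rval r s))\<rparr>)"
  "wpt (Seq p q) s Q = wpt p s (\<lambda>t s'. wpt q s' (\<lambda>t'. Q (t + t')))"
  "wpt (Cond b p q) s Q = wpt (if bval b s then p else q) s (\<lambda>t. Q (1 + btime b + t))"
proof -
  show "wpt Skip s Q = Q 1 s"
    unfolding wpt_def by (metis SkipE exec.Skip)
  show "wpt (NAssign a e) s Q = Q (1 + ntime e) (s\<lparr>nvar := (nvar s)(a := nval e s)\<rparr>)"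
    unfolding wpt_def by (metis NAssignE exec.NAssign)
  show "wpt (NStore a i e) s Q = Q (1 + ntime i + ntime e)
     (s\<lparr>narr := (narr s)(a := (narr s a)(nval i s := nval e s))\<rparr>)"
    unfolding wpt_def by (metis NStoreE exec.NStore)
  show "wpt (RAssign a r) s Q = Q (1 + rtime r) (s\<lparr>rvar := (rvar s)(a := rval r s)\<rparr>)"
    unfolding wpt_def by (metis RAssignE exec.RAssign)
  show "wpt (RStore a i r) s Q = Q (1 + ntime i + rtime r)
     (s\<lparr>rarr := (rarr s)(a := (rarr s a)(nval i s := rval r s))\<rparr>)"
    unfolding wpt_def by (metis RStoreE exec.RStore)
  show "wpt (Seq p q) s Q = wpt p s (\<lambda>t s'. wpt q s' (\<lambda>t'. Q (t + t')))"
    unfolding wpt_def by (blast elim: SeqE intro: exec.Seq)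
  show "wpt (Cond b p q) s Q = wpt (if bval b s then p else q) s (\<lambda>t. Q (1 + btime b + t))"
  proof
    assume "wpt (Cond b p q) s Q"
    then obtain t s' where "exec (Cond b p q) s t s'" "Q t s'" unfolding wpt_def by blast
    then show "wpt (if bval b s then p else q) s (\<lambda>t. Q (1 + btime b + t))"
      unfolding wpt_def by (auto elim!: CondE)
  next
    assume "wpt (if bval b s then p else q) s (\<lambda>t. Q (1 + btime b + t))"
    then obtain t s' where "exec (if bval b s then p else q) s t s'" "Q (1 + btime b + t) s'"
      unfolding wpt_def by blast
    then show "wpt (Cond b p q) s Q"
      unfolding wpt_def by (metis CondTrue CondFalse)
  qed
qed

lemma wpt_mono: "wpt p s Q \<Longrightarrow> (\<And>t s'. Q t s' \<Longrightarrow> Q' t s') \<Longrightarrow> wpt p s Q'"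
  unfolding wpt_def by blast

text \<open>Induction on the number j of remaining iterations, with an invariant indexed by the
  completed ones. The summand 1 in j + 1 pays for the final failing test.\<close>

lemma wpt_while:
  assumes test: "\<And>k s. k \<le> N \<Longrightarrow> I k s \<Longrightarrow> bval b s = (k < N)"
    and body: "\<And>k s. k < N \<Longrightarrow> I k s \<Longrightarrow> wpt p s (\<lambda>t s'. t \<le> c \<and> I (Suc k) s')"
  shows "j \<le> N \<Longrightarrow> I (N - j) s \<Longrightarrow>
    wpt (While b p) s (\<lambda>t s'. t \<le> (j + 1) * (1 + btime b + c) \<and> I N s')"
proof (induction j arbitrary: s)
  case 0
  then show ?case using test[of N s] unfolding wpt_def by (auto intro!: exI WhileFalse)
next
  case (Suc j)
  let ?k = "N - Suc j"
  have k: "?k < N" "Suc ?k = N - j" using Suc.prems by auto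
  obtain t s' where 1: "exec p s t s'" "t \<le> c" "I (N - j) s'"
    using body[OF k(1) Suc.prems(2)] k(2) unfolding wpt_def by auto
  moreover obtain t' s'' where 2: "exec (While b p) s' t' s''"
    "t' \<le> (j + 1) * (1 + btime b + c)" "I N s''"
    using Suc.IH[OF _ 1(3)] Suc.prems unfolding wpt_def by auto
  moreover have "bval b s" using test[of ?k s] k Suc.prems by simp
  ultimately have "exec (While b p) s (1 + btime b + t + t') s''" by (intro WhileTrue)
  moreover have "1 + btime b + t + t' \<le> (Suc j + 1) * (1 + btime b + c)" using 1(2) 2(2) by simp
  ultimately show ?case unfolding wpt_def using 2(3) by blast
qed

definition for_com :: "string \<Rightarrow> nexp \<Rightarrow> com \<Rightarrow> com" where
  "for_com i e p = Seq (NAssign i (NConst 0))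
     (While (NLess (NVar i) e) (Seq p (NAssign i (NAdd (NVar i) (NConst 1)))))"

text \<open>Initialization costs 2; each round costs 3 + \<open>ntime e\<close> for the test and 4
  for the increment. The bound \<open>e\<close> is evaluated anew at every test, so the invariant
  has to fix its value at N.\<close>

lemma wpt_for_com:
  assumes "I 0 (s\<lparr>nvar := (nvar s)(i := 0)\<rparr>)"
    and test: "\<And>k s. k \<le> N \<Longrightarrow> I k s \<Longrightarrow> nvar s i = k \<and> nval e s = N"
    and body: "\<And>k s. k < N \<Longrightarrow> I k s \<Longrightarrow>
      wpt p s (\<lambda>t s'. t \<le> c \<and> nvar s' i = k \<and> I (Suc k) (s'\<lparr>nvar := (nvar s')(i := Suc k)\<rparr>))"
  shows "wpt (for_com i e p) s (\<lambda>t s'. t \<le> 2 + (N + 1) * (7 + ntime e + c) \<and> I N s')"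
proof -
  have "wpt (While (NLess (NVar i) e) (Seq p (NAssign i (NAdd (NVar i) (NConst 1)))))
      (s\<lparr>nvar := (nvar s)(i := 0)\<rparr>)
      (\<lambda>t s'. t \<le> (N + 1) * (1 + btime (NLess (NVar i) e) + (c + 4)) \<and> I N s')"
  proof (rule wpt_while[where N = N and I = I])
    fix k s assume "k < N" "I k s"
    from body[OF this] show "wpt (Seq p (NAssign i (NAdd (NVar i) (NConst 1)))) s
        (\<lambda>t s'. t \<le> c + 4 \<and> I (Suc k) s')"
      by (auto elim: wpt_mono)
  qed (use assms in auto)
  then show ?thesis unfolding for_com_def by (auto simp: algebra_simps elim!: wpt_mono)
qed

primrec block :: "com list \<Rightarrow> com" where
  "block [] = Skip"
| "block (p # ps) = Seq p (block ps)"

definition bor :: "bexp \<Rightarrow> bexp \<Rightarrow> bexp" where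
  "bor b b' = BNot (BAnd (BNot b) (BNot b'))"

lemma bor_simps [simp]:
  "bval (bor b b') s = (bval b s \<or> bval b' s)" "btime (bor b b') = 4 + btime b + btime b'"
  by (auto simp: bor_def)

section \<open>The rounding program\<close>

text \<open>Occupied parts are numbered 1 to m in order of first appearance. Since d is not bounded
  in terms of n, the later phases must work with m \<le> n instead.\<close>

definition label_parts :: com where
  "label_parts = for_com ''i'' (NVar ''n'')
     (block [Cond (NEq (NArr ''lab'' (NArr ''part'' (NVar ''i''))) (NConst 0))
        (Seq (NAssign ''m'' (NAdd (NVar ''m'') (NConst 1)))
          (NStore ''lab'' (NArr ''part'' (NVar ''i'')) (NVar ''m''))) Skip,
       NStore ''q'' (NVar ''i'') (NArr ''lab'' (NArr ''part'' (NVar ''i'')))])"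

lemma wpt_label_parts:
  assumes s: "nvar s ''n'' = n" "nvar s ''m'' = 0" "narr s ''part'' = p"
    "narr s ''lab'' = (\<lambda>_. 0)" "rarr s = ra"
  shows "wpt label_parts s (\<lambda>t s'. t \<le> 2 + (n + 1) * 40 \<and> nvar s' ''n'' = n \<and> rarr s' = ra \<and>
     nvar s' ''m'' = card (p ` {..<n}) \<and>
     (\<exists>lab. bij_betw lab (p ` {..<n}) {1..card (p ` {..<n})} \<and>
        (\<forall>i<n. narr s' ''q'' i = lab (p i))))"
proof -
  define I where "I k s \<longleftrightarrow> nvar s ''i'' = k \<and> nvar s ''n'' = n \<and> narr s ''part'' = p \<and> rarr s = ra \<and>
    nvar s ''m'' = card (p ` {..<k}) \<and>
    bij_betw (narr s ''lab'') (p ` {..<k}) {1..card (p ` {..<k})} \<and>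
    (\<forall>j. j \<notin> p ` {..<k} \<longrightarrow> narr s ''lab'' j = 0) \<and> (\<forall>i<k. narr s ''q'' i = narr s ''lab'' (p i))"
    for k and s :: state
  have "wpt label_parts s (\<lambda>t s'. t \<le> 2 + (n + 1) * (7 + ntime (NVar ''n'') + 32) \<and> I n s')"
    unfolding label_parts_def
  proof (rule wpt_for_com)
    show "I 0 (s\<lparr>nvar := (nvar s)(''i'' := 0)\<rparr>)" using s by (simp add: I_def bij_betw_def)
  next
    fix k s assume I: "I k s"
    let ?l = "narr s ''lab''"
    \<comment> \<open>Labels start at 1, so the entry 0 unambiguously marks an unseen part.\<close>
    have "bij_betw ?l (p ` {..<k}) {1..card (p ` {..<k})}" using I by (simp only: I_def)
    from bij_betwE[OF this] have pos: "?l (p k) \<noteq> 0" if "p k \<in> p ` {..<k}"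
      using that by force
    have "\<forall>j. j \<notin> p ` {..<k} \<longrightarrow> ?l j = 0"
      using I unfolding I_def by (elim conjE)
    then have zero: "?l (p k) = 0" if "p k \<notin> p ` {..<k}" using that by blast
    have new: "bij_betw (?l(p k := Suc (card (p ` {..<k})))) (insert (p k) (p ` {..<k}))
        {1..Suc (card (p ` {..<k}))}" if "p k \<notin> p ` {..<k}"
    proof -
      have "bij_betw (?l(p k := Suc (card (p ` {..<k})))) (p ` {..<k}) {1..card (p ` {..<k})}"
        using I that unfolding I_def by (metis bij_betw_cong fun_upd_other)
      from notIn_Un_bij_betw[OF that _ this] show ?thesis
        by (simp add: atLeastAtMostSuc_conv)
    qed
    have old: "insert (p k) (p ` {..<k}) = p ` {..<k}" if "p k \<in> p ` {..<k}"
      using that by auto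
    show "wpt (block [Cond (NEq (NArr ''lab'' (NArr ''part'' (NVar ''i''))) (NConst 0))
        (Seq (NAssign ''m'' (NAdd (NVar ''m'') (NConst 1)))
          (NStore ''lab'' (NArr ''part'' (NVar ''i'')) (NVar ''m''))) Skip,
       NStore ''q'' (NVar ''i'') (NArr ''lab'' (NArr ''part'' (NVar ''i'')))]) s
       (\<lambda>t s'. t \<le> 32 \<and> nvar s' ''i'' = k \<and> I (Suc k) (s'\<lparr>nvar := (nvar s')(''i'' := Suc k)\<rparr>))"
    proof (cases "p k \<in> p ` {..<k}")
      case True
      have "p ` {..<Suc k} = p ` {..<k}" using old[OF True] by (simp add: lessThan_Suc)
      then show ?thesis using I pos[OF True]
        by (auto simp add: I_def less_Suc_eq)
    next
      case False
      have "p ` {..<Suc k} = insert (p k) (p ` {..<k})" by (simp add: lessThan_Suc)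
      moreover have "p i \<noteq> p k" if "i < k" for i using that False by (metis imageI lessThan_iff)
      ultimately show ?thesis using I zero[OF False] new[OF False] False
        by (simp add: I_def less_Suc_eq)
    qed
  qed (auto simp: I_def)
  then show ?thesis
  proof (rule wpt_mono)
    fix t s'
    assume t: "t \<le> 2 + (n + 1) * (7 + ntime (NVar ''n'') + 32) \<and> I n s'"
    then have "bij_betw (narr s' ''lab'') (p ` {..<n}) {1..card (p ` {..<n})}"
      "\<forall>i<n. narr s' ''q'' i = narr s' ''lab'' (p i)" unfolding I_def by blast+
    with t show "t \<le> 2 + (n + 1) * 40 \<and> nvar s' ''n'' = n \<and> rarr s' = ra \<and>
     nvar s' ''m'' = card (p ` {..<n}) \<and>
     (\<exists>lab. bij_betw lab (p ` {..<n}) {1..card (p ` {..<n})} \<and>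
        (\<forall>i<n. narr s' ''q'' i = lab (p i)))"
      by (intro conjI exI[of _ "narr s' ''lab''"]) (simp_all add: I_def)
  qed
qed

text \<open>The machine has no remainder operation; a counter that is reset at 4 produces the
  residues.\<close>

definition cycle_roles :: com where
  "cycle_roles = for_com ''i'' (NAdd (NVar ''m'') (NConst 1))
     (block [NStore ''R'' (NVar ''i'') (NVar ''k''),
        NAssign ''k'' (NAdd (NVar ''k'') (NConst 1)),
        Cond (NEq (NVar ''k'') (NConst 4)) (NAssign ''k'' (NConst 0)) Skip])"

lemma wpt_cycle_roles:
  assumes s: "nvar s ''n'' = n" "nvar s ''m'' = m" "narr s ''q'' = q" "rarr s = ra" "nvar s ''k'' = 0"
  shows "wpt cycle_roles s (\<lambda>t s'. t \<le> 2 + (m + 2) * 30 \<and>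
     nvar s' ''n'' = n \<and> nvar s' ''m'' = m \<and> narr s' ''q'' = q \<and> rarr s' = ra \<and>
     (\<forall>j\<le>m. narr s' ''R'' j = j mod 4))"
proof -
  define I where "I k s \<longleftrightarrow> nvar s ''i'' = k \<and> nvar s ''n'' = n \<and> nvar s ''m'' = m \<and>
    narr s ''q'' = q \<and> rarr s = ra \<and> nvar s ''k'' = k mod 4 \<and> (\<forall>j<k. narr s ''R'' j = j mod 4)"
    for k and s :: state
  have "wpt cycle_roles s (\<lambda>t s'. t \<le> 2 + (Suc m + 1) *
       (7 + ntime (NAdd (NVar ''m'') (NConst 1)) + 20) \<and> I (Suc m) s')"
    unfolding cycle_roles_def
  proof (rule wpt_for_com[where I = I])
    fix k s assume I: "I k s"
    have "k mod 4 < 4" by simp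
    then consider "k mod 4 = 3" "Suc k mod 4 = 0" | "k mod 4 < 3" "Suc k mod 4 = Suc (k mod 4)"
      by (simp add: mod_Suc) linarith
    then show "wpt (block [NStore ''R'' (NVar ''i'') (NVar ''k''),
          NAssign ''k'' (NAdd (NVar ''k'') (NConst 1)),
          Cond (NEq (NVar ''k'') (NConst 4)) (NAssign ''k'' (NConst 0)) Skip]) s
       (\<lambda>t s'. t \<le> 20 \<and> nvar s' ''i'' = k \<and> I (Suc k) (s'\<lparr>nvar := (nvar s')(''i'' := Suc k)\<rparr>))"
      using I by cases (auto simp: I_def less_Suc_eq)
  qed (use s in \<open>auto simp: I_def\<close>)
  then show ?thesis by (rule wpt_mono) (auto simp: I_def less_Suc_eq_le)
qed

text \<open>The parity of m is read off its residue, which is 1 or 3 exactly for odd m. If m < 4,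
  the padded value D = 4 is even and the residues stay as they are.\<close>

definition assign_roles :: com where
  "assign_roles = block [
     NAssign ''k'' (NConst 0),
     cycle_roles,
     NAssign ''D'' (NVar ''m''),
     Cond (NLess (NVar ''m'') (NConst 4)) (NAssign ''D'' (NConst 4))
       (Cond (bor (NEq (NArr ''R'' (NVar ''m'')) (NConst 1)) (NEq (NArr ''R'' (NVar ''m'')) (NConst 3)))
         (Seq (NStore ''R'' (NConst 2) (NConst 4)) (NStore ''R'' (NVar ''m'') (NConst 5))) Skip)]"

lemma wpt_assign_roles:
  assumes s: "nvar s ''n'' = n" "nvar s ''m'' = m" "narr s ''q'' = q" "rarr s = ra"
  shows "wpt assign_roles s (\<lambda>t s'. t \<le> 60 + (m + 2) * 30 \<and>
     nvar s' ''n'' = n \<and> narr s' ''q'' = q \<and> rarr s' = ra \<and> nvar s' ''D'' = max 4 m \<and>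
     (\<forall>j\<in>{1..m}. narr s' ''R'' j = role (max 4 m) j))"
proof -
  have cycle: "wpt cycle_roles (s\<lparr>nvar := (nvar s)(''k'' := 0)\<rparr>) (\<lambda>t s'. t \<le> 2 + (m + 2) * 30 \<and>
     nvar s' ''n'' = n \<and> nvar s' ''m'' = m \<and> narr s' ''q'' = q \<and> rarr s' = ra \<and>
     (\<forall>j\<le>m. narr s' ''R'' j = j mod 4))"
    by (rule wpt_cycle_roles) (simp_all add: s)
  have odd: "m mod 4 = Suc 0 \<or> m mod 4 = 3 \<longleftrightarrow> odd m" by presburger
  show ?thesis
    unfolding assign_roles_def block.simps wpt_simps nval.simps
    using odd by (intro wpt_mono[OF cycle]) (cases "m < 4"; auto simp: role_def max_def)
qed

definition scale_loop :: com where
  "scale_loop = for_com ''i'' (NVar ''n'')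
       (block [RStore ''z'' (NVar ''i'') (RMul (RVar ''al'') (RArr ''x'' (NVar ''i''))),
          RStore ''cand'' (NVar ''k'') (RArr ''z'' (NVar ''i'')),
          RStore ''cand'' (NAdd (NVar ''k'') (NConst 1)) (RSub (RNat (NConst 1)) (RArr ''z'' (NVar ''i''))),
          RStore ''cand'' (NAdd (NVar ''k'') (NConst 2))
            (RSub (RArr ''z'' (NVar ''i'')) (RDiv (RNat (NConst 1)) (RNat (NConst 2)))),
          RStore ''cand'' (NAdd (NVar ''k'') (NConst 3))
            (RAdd (RArr ''z'' (NVar ''i'')) (RDiv (RNat (NConst 1)) (RNat (NConst 2)))),
          RStore ''cand'' (NAdd (NVar ''k'') (NConst 4))
            (RDiv (RSub (RNat (NConst 1)) (RArr ''z'' (NVar ''i''))) (RNat (NConst 2))),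
          RStore ''cand'' (NAdd (NVar ''k'') (NConst 5))
            (RSub (RNat (NConst 1)) (RDiv (RArr ''z'' (NVar ''i'')) (RNat (NConst 2)))),
          NAssign ''k'' (NAdd (NVar ''k'') (NConst 6))])"

text \<open>Entry 0 of \<open>cand\<close> is the candidate 0 because memory starts out zero, and
  entry 1 is 1/2; the breakpoints of vertex i begin at index 2 + 6i.\<close>

definition scale_and_breakpoints :: com where
  "scale_and_breakpoints = block [
     RAssign ''al'' (RSub (RDiv (RNat (NVar ''D'')) (RNat (NConst 2)))
        (RDiv (RNat (NVar ''D'')) (RMul (RNat (NConst 128)) (RNat (NVar ''n''))))),
     RStore ''cand'' (NConst 1) (RDiv (RNat (NConst 1)) (RNat (NConst 2))),
     NAssign ''k'' (NConst 2),
     scale_loop]"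

definition ready ::
  "nat \<Rightarrow> nat \<Rightarrow> (nat \<Rightarrow> nat) \<Rightarrow> (nat \<Rightarrow> real) \<Rightarrow> (nat \<Rightarrow> real) \<Rightarrow> real \<Rightarrow> nat \<Rightarrow> (nat \<Rightarrow> real) \<Rightarrow> state \<Rightarrow> bool"
  where "ready n D q c z \<alpha> K C s \<longleftrightarrow> nvar s ''n'' = n \<and> nvar s ''k'' = K \<and> narr s ''q'' = q \<and>
     (\<forall>i<n. narr s ''R'' (q i) = role D (q i)) \<and>
     rarr s ''c'' = c \<and> rarr s ''z'' = z \<and> rvar s ''al'' = \<alpha> \<and> rarr s ''cand'' = C"

lemma image_lessThan_add_6:
  "f ` {..<k + 6} = f ` {..<k} \<union> {f k, f (k+1), f (k+2), f (k+3), f (k+4), f (k+5::nat)}"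
proof -
  have "{..<k + 6} = {..<k} \<union> {k, k+1, k+2, k+3, k+4, k+5}" by auto
  then show ?thesis by (simp only: image_Un image_insert image_empty)
qed

lemma wpt_scale_and_breakpoints:
  assumes s: "nvar s ''n'' = n" "narr s ''q'' = q" "nvar s ''D'' = D"
    "\<And>i. i < n \<Longrightarrow> narr s ''R'' (q i) = role D (q i)"
    "rarr s ''c'' = c" "rarr s ''x'' = x" "rarr s ''cand'' = (\<lambda>_. 0)"
    and \<alpha>: "\<alpha> = real D / 2 - real D / (128 * real n)"
  shows "wpt scale_and_breakpoints s (\<lambda>t s'. t \<le> 60 + (n + 1) * 110 \<and>
     (\<exists>z C. ready n D q c z \<alpha> (2 + 6 * n) C s' \<and> (\<forall>i<n. z i = \<alpha> * x i) \<and>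
        {0, 1/2} \<union> (\<Union>i<n. breakpoints (z i)) \<subseteq> C ` {..<2 + 6 * n}))"
proof -
  define G where "G k C \<longleftrightarrow>
     {0, 1/2} \<union> (\<Union>i<k. breakpoints (\<alpha> * x i)) \<subseteq> C ` {..<2 + 6 * k}" for k and C :: "nat \<Rightarrow> real"
  define I where "I k s \<longleftrightarrow> nvar s ''i'' = k \<and> nvar s ''n'' = n \<and> narr s ''q'' = q \<and>
     (\<forall>i<n. narr s ''R'' (q i) = role D (q i)) \<and> rarr s ''c'' = c \<and> rarr s ''x'' = x \<and>
     rvar s ''al'' = \<alpha> \<and> nvar s ''k'' = 2 + 6 * k \<and> (\<forall>i<k. rarr s ''z'' i = \<alpha> * x i) \<and>
     G k (rarr s ''cand'')" for k and s :: state
  have loop: "wpt scale_loop s (\<lambda>t s'. t \<le> 2 + (n + 1) * (7 + ntime (NVar ''n'') + 100) \<and> I n s')"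
    if I0: "I 0 (s\<lparr>nvar := (nvar s)(''i'' := 0)\<rparr>)" for s
    unfolding scale_loop_def
  proof (rule wpt_for_com[where I = I, OF I0])
    fix k s assume I: "I k s"
    define C' where "C' = (rarr s ''cand'')(2+6*k := \<alpha> * x k, 2+6*k+1 := 1 - \<alpha> * x k,
      2+6*k+2 := \<alpha> * x k - 1/2, 2+6*k+3 := \<alpha> * x k + 1/2, 2+6*k+4 := (1 - \<alpha> * x k) / 2,
      2+6*k+5 := 1 - \<alpha> * x k / 2)"
    \<comment> \<open>The six writes of this round lie beyond the segment filled so far.\<close>
    have "C' ` {..<2+6*k} = rarr s ''cand'' ` {..<2+6*k}"
      by (intro image_cong) (auto simp: C'_def)
    then have "C' ` {..<2+6*k+6} = rarr s ''cand'' ` {..<2+6*k} \<union> breakpoints (\<alpha> * x k)"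
      unfolding image_lessThan_add_6 by (simp add: C'_def breakpoints_def insert_commute)
    moreover have "2 + 6 * Suc k = 2 + 6 * k + 6" by simp
    ultimately have "G (Suc k) C'"
      using I unfolding I_def G_def by (simp only: lessThan_Suc UN_insert) blast
    with I show "wpt (block [RStore ''z'' (NVar ''i'') (RMul (RVar ''al'') (RArr ''x'' (NVar ''i''))),
          RStore ''cand'' (NVar ''k'') (RArr ''z'' (NVar ''i'')),
          RStore ''cand'' (NAdd (NVar ''k'') (NConst 1)) (RSub (RNat (NConst 1)) (RArr ''z'' (NVar ''i''))),
          RStore ''cand'' (NAdd (NVar ''k'') (NConst 2))
            (RSub (RArr ''z'' (NVar ''i'')) (RDiv (RNat (NConst 1)) (RNat (NConst 2)))),
          RStore ''cand'' (NAdd (NVar ''k'') (NConst 3))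
            (RAdd (RArr ''z'' (NVar ''i'')) (RDiv (RNat (NConst 1)) (RNat (NConst 2)))),
          RStore ''cand'' (NAdd (NVar ''k'') (NConst 4))
            (RDiv (RSub (RNat (NConst 1)) (RArr ''z'' (NVar ''i''))) (RNat (NConst 2))),
          RStore ''cand'' (NAdd (NVar ''k'') (NConst 5))
            (RSub (RNat (NConst 1)) (RDiv (RArr ''z'' (NVar ''i'')) (RNat (NConst 2)))),
          NAssign ''k'' (NAdd (NVar ''k'') (NConst 6))]) s (\<lambda>t s'. t \<le> 100 \<and> nvar s' ''i'' = k \<and>
        I (Suc k) (s'\<lparr>nvar := (nvar s')(''i'' := Suc k)\<rparr>))"
      unfolding C'_def by (simp add: I_def less_Suc_eq)
  qed (auto simp: I_def)
  have G0: "G 0 C" if "C 0 = 0" "C 1 = 1/2" for C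
  proof -
    have "{C 0, C 1} \<subseteq> C ` {..<2}" by auto
    then show ?thesis using that by (simp add: G_def)
  qed
  show ?thesis
    unfolding scale_and_breakpoints_def block.simps wpt_simps
    by (rule wpt_mono[OF loop], (auto simp: I_def s \<alpha> intro!: G0)[1],
        simp add: I_def G_def ready_def)
qed

section \<open>Evaluating one pair of parameters and searching over all pairs\<close>

abbreviation half :: rexp where "half \<equiv> RDiv (RNat (NConst 1)) (RNat (NConst 2))"
abbreviation vertex_role :: nexp where "vertex_role \<equiv> NArr ''R'' (NArr ''q'' (NVar ''i''))"
abbreviation vertex_value :: rexp where "vertex_value \<equiv> RArr ''z'' (NVar ''i'')"

text \<open>One disjunct per role. The machine compares reals only by < and =, so a weak inequality
  appears as a negated strict one.\<close>

definition selection_test :: bexp where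
  "selection_test =
     bor (BAnd (NEq vertex_role (NConst 0))
            (BNot (RLess vertex_value (RSub (RNat (NConst 1)) (RVar ''u''))))) (
     bor (BAnd (NEq vertex_role (NConst 1)) (RLess (RVar ''v'') vertex_value)) (
     bor (BAnd (NEq vertex_role (NConst 2))
            (BNot (RLess vertex_value (RSub (RNat (NConst 1)) (RVar ''v''))))) (
     bor (BAnd (NEq vertex_role (NConst 3)) (RLess (RVar ''u'') vertex_value)) (
     bor (BAnd (NEq vertex_role (NConst 4))
            (bor (BAnd (RLess (RVar ''v'') half) (RLess (RAdd (RVar ''v'') half) vertex_value))
               (BAnd (BNot (RLess (RVar ''v'') half)) (RLess (RSub (RVar ''v'') half) vertex_value))))
       (BAnd (NLess (NConst 4) vertex_role)
            (bor (BAnd (RLess (RVar ''v'') half) (BNot (RLess vertex_value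
                (RSub (RNat (NConst 1)) (RMul (RNat (NConst 2)) (RVar ''v''))))))
               (BAnd (BNot (RLess (RVar ''v'') half)) (BNot (RLess vertex_value
                (RSub (RNat (NConst 2)) (RMul (RNat (NConst 2)) (RVar ''v'')))))))))))) "

lemma bval_selection_test:
  assumes "ready n D q c z \<alpha> K C s" "nvar s ''i'' < n"
  shows "bval selection_test s = chosen D q z (rvar s ''u'') (rvar s ''v'') (nvar s ''i'')"
proof -
  have [simp]: "narr s ''q'' = q" "rarr s ''z'' = z"
    "narr s ''R'' (q (nvar s ''i'')) = role D (q (nvar s ''i''))"
    using assms by (simp_all add: ready_def)
  consider "role D (q (nvar s ''i'')) \<in> {0, 1, 2, 3, 4}" | "4 < role D (q (nvar s ''i''))"
    by fastforce
  then show ?thesis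
    by cases (auto simp: selection_test_def chosen_def selected_def threshold_def not_less)
qed

lemma btime_selection_test: "btime selection_test \<le> 210"
  by (simp add: selection_test_def)

text \<open>Going through \<open>q\<close> clears exactly the labels in use, in linear time, before
  the array serves the next pair.\<close>

definition clear_heights :: com where
  "clear_heights = for_com ''i'' (NVar ''n'')
     (RStore ''h'' (NArr ''q'' (NVar ''i'')) (RNat (NConst 0)))"

definition accumulate :: com where
  "accumulate = for_com ''i'' (NVar ''n'')
     (Cond selection_test
        (RAssign ''cost'' (RAdd (RVar ''cost'') (RArr ''c'' (NVar ''i''))))
        (Cond (RLess (RArr ''h'' (NArr ''q'' (NVar ''i''))) vertex_value)
           (Seq (RAssign ''hs'' (RAdd (RVar ''hs'')
                   (RSub vertex_value (RArr ''h'' (NArr ''q'' (NVar ''i''))))))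
              (RStore ''h'' (NArr ''q'' (NVar ''i'')) vertex_value))
           Skip))"

definition update_best :: com where
  "update_best =
     Cond (BAnd (RLess (RVar ''hs'') (RVar ''al''))
            (bor (NEq (NVar ''found'') (NConst 0)) (RLess (RVar ''cost'') (RVar ''best''))))
       (block [NAssign ''found'' (NConst 1), RAssign ''best'' (RVar ''cost''),
          RAssign ''bu'' (RVar ''u''), RAssign ''bv'' (RVar ''v'')]) Skip"

definition try_pair :: com where
  "try_pair = block [
     RAssign ''u'' (RArr ''cand'' (NVar ''a'')), RAssign ''v'' (RArr ''cand'' (NVar ''b'')),
     RAssign ''cost'' (RNat (NConst 0)), RAssign ''hs'' (RNat (NConst 0)),
     clear_heights, accumulate, update_best]"

text \<open>Invariant of a minimum search over the pairs P tried so far, restricted to those of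
  total height below \<alpha>. The flag \<open>found\<close> stands in for an infinite initial value
  of \<open>best\<close>.\<close>

definition incumbent ::
  "nat \<Rightarrow> nat \<Rightarrow> (nat \<Rightarrow> nat) \<Rightarrow> (nat \<Rightarrow> real) \<Rightarrow> (nat \<Rightarrow> real) \<Rightarrow> real \<Rightarrow> (real \<times> real) set \<Rightarrow> state \<Rightarrow> bool"
  where "incumbent n D q c z \<alpha> P s \<longleftrightarrow>
    (if nvar s ''found'' = 0 then \<forall>(u, v)\<in>P. \<not> total_height n D q z u v < \<alpha>
     else total_height n D q z (rvar s ''bu'') (rvar s ''bv'') < \<alpha> \<and>
       rvar s ''best'' = choice_cost n D q c z (rvar s ''bu'') (rvar s ''bv'') \<and>
       (\<forall>(u, v)\<in>P. total_height n D q z u v < \<alpha> \<longrightarrow> rvar s ''best'' \<le> choice_cost n D q c z u v))"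

lemma incumbent_nvar [simp]:
  "y \<noteq> ''found'' \<Longrightarrow>
    incumbent n D q c z \<alpha> P (s\<lparr>nvar := (nvar s)(y := k)\<rparr>) = incumbent n D q c z \<alpha> P s"
  by (simp add: incumbent_def)

definition loop_frame ::
  "nat \<Rightarrow> nat \<Rightarrow> (nat \<Rightarrow> nat) \<Rightarrow> (nat \<Rightarrow> real) \<Rightarrow> (nat \<Rightarrow> real) \<Rightarrow> real \<Rightarrow> nat \<Rightarrow> (nat \<Rightarrow> real) \<Rightarrow>
   (real \<times> real) set \<Rightarrow> nat \<Rightarrow> nat \<Rightarrow> state \<Rightarrow> bool"
  where "loop_frame n D q c z \<alpha> K C P a b s \<longleftrightarrow> ready n D q c z \<alpha> K C s \<and>
     incumbent n D q c z \<alpha> P s \<and> nvar s ''a'' = a \<and> nvar s ''b'' = b"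

text \<open>A frame rule: writes to other names preserve the bundle, so the inner loops need not
  unfold it.\<close>

lemma loop_frame_update:
  "\<forall>y\<in>{''n'', ''k'', ''a'', ''b'', ''found''}. f y = nvar s y \<Longrightarrow>
    loop_frame n D q c z \<alpha> K C P a b (s\<lparr>nvar := f\<rparr>) = loop_frame n D q c z \<alpha> K C P a b s"
  "\<forall>y\<in>{''al'', ''bu'', ''bv'', ''best''}. g y = rvar s y \<Longrightarrow>
    loop_frame n D q c z \<alpha> K C P a b (s\<lparr>rvar := g\<rparr>) = loop_frame n D q c z \<alpha> K C P a b s"
  "\<forall>y\<in>{''c'', ''z'', ''cand''}. h y = rarr s y \<Longrightarrow>
    loop_frame n D q c z \<alpha> K C P a b (s\<lparr>rarr := h\<rparr>) = loop_frame n D q c z \<alpha> K C P a b s"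
  by (simp_all add: loop_frame_def ready_def incumbent_def)

lemma wpt_clear_heights:
  assumes F: "loop_frame n D q c z \<alpha> K C P a b s"
    and rv: "rvar s ''u'' = u" "rvar s ''v'' = v" "rvar s ''cost'' = 0" "rvar s ''hs'' = 0"
  shows "wpt clear_heights s (\<lambda>t s'. t \<le> 2 + (n + 1) * 20 \<and> loop_frame n D q c z \<alpha> K C P a b s' \<and>
     rvar s' ''u'' = u \<and> rvar s' ''v'' = v \<and> rvar s' ''cost'' = 0 \<and> rvar s' ''hs'' = 0 \<and>
     (\<forall>j\<in>q ` {..<n}. rarr s' ''h'' j = 0))"
proof -
  define I where "I k s \<longleftrightarrow> loop_frame n D q c z \<alpha> K C P a b s \<and> nvar s ''i'' = k \<and>
     rvar s ''u'' = u \<and> rvar s ''v'' = v \<and> rvar s ''cost'' = 0 \<and> rvar s ''hs'' = 0 \<and>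
     (\<forall>j\<in>q ` {..<k}. rarr s ''h'' j = 0)" for k and s :: state
  have frame: "narr s ''q'' = q \<and> nvar s ''n'' = n" if "loop_frame n D q c z \<alpha> K C P a b s" for s
    using that by (simp add: loop_frame_def ready_def)
  have "wpt clear_heights s (\<lambda>t s'. t \<le> 2 + (n + 1) * (7 + ntime (NVar ''n'') + 10) \<and> I n s')"
    unfolding clear_heights_def
  proof (rule wpt_for_com[where I = I])
    fix k s assume "k < n" "I k s"
    then show "wpt (RStore ''h'' (NArr ''q'' (NVar ''i'')) (RNat (NConst 0))) s
        (\<lambda>t s'. t \<le> 10 \<and> nvar s' ''i'' = k \<and> I (Suc k) (s'\<lparr>nvar := (nvar s')(''i'' := Suc k)\<rparr>))"
      using frame[of s]
      by (auto simp: I_def lessThan_Suc loop_frame_update)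
  qed (use F rv frame in \<open>auto simp: I_def loop_frame_update\<close>)
  then show ?thesis by (rule wpt_mono) (auto simp: I_def)
qed

text \<open>Vertex k can change only the summand of its own label, so the program maintains the
  total in constant time per vertex.\<close>

lemma sum_height_Suc:
  assumes "k < n"
  shows "(\<Sum>j\<in>q ` {..<n}. height S z q (Suc k) j) = (\<Sum>j\<in>q ` {..<n}. height S z q k j) +
    (if S k then 0 else max (height S z q k (q k)) (z k) - height S z q k (q k))"
proof -
  have "q k \<in> q ` {..<n}" using assms by simp
  then have "sum f (q ` {..<n}) = f (q k) + sum f (q ` {..<n} - {q k})" for f :: "nat \<Rightarrow> real"
    by (simp add: sum.remove)
  moreover have "(\<Sum>j\<in>q ` {..<n} - {q k}. height S z q (Suc k) j)
      = (\<Sum>j\<in>q ` {..<n} - {q k}. height S z q k j)"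
    by (rule sum.cong) auto
  ultimately show ?thesis by simp
qed

lemma wpt_accumulate:
  assumes F: "loop_frame n D q c z \<alpha> K C P a b s"
    and rv: "rvar s ''u'' = u" "rvar s ''v'' = v" "rvar s ''cost'' = 0" "rvar s ''hs'' = 0"
    "\<forall>j\<in>q ` {..<n}. rarr s ''h'' j = 0"
  shows "wpt accumulate s (\<lambda>t s'. t \<le> 2 + (n + 1) * 300 \<and> loop_frame n D q c z \<alpha> K C P a b s' \<and>
     rvar s' ''u'' = u \<and> rvar s' ''v'' = v \<and> rvar s' ''cost'' = choice_cost n D q c z u v \<and>
     rvar s' ''hs'' = total_height n D q z u v)"
proof -
  define S where "S = chosen D q z u v"
  define W where "W k = (\<Sum>j\<in>q ` {..<n}. height S z q k j)" for k
  define I where "I k s \<longleftrightarrow> loop_frame n D q c z \<alpha> K C P a b s \<and> nvar s ''i'' = k \<and>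
     rvar s ''u'' = u \<and> rvar s ''v'' = v \<and> rvar s ''cost'' = (\<Sum>i<k. if S i then c i else 0) \<and>
     rvar s ''hs'' = W k \<and>
     (\<forall>j\<in>q ` {..<n}. rarr s ''h'' j = height S z q k j)" for k and s :: state
  have frame: "narr s ''q'' = q \<and> nvar s ''n'' = n \<and> rarr s ''z'' = z \<and> rarr s ''c'' = c \<and>
      ready n D q c z \<alpha> K C s"
    if "loop_frame n D q c z \<alpha> K C P a b s" for s
    using that by (simp add: loop_frame_def ready_def)
  have "wpt accumulate s (\<lambda>t s'. t \<le> 2 + (n + 1) * (7 + ntime (NVar ''n'') + 250) \<and> I n s')"
    unfolding accumulate_def
  proof (rule wpt_for_com[where I = I])
    fix k s assume k: "k < n" and I: "I k s"
    then have fr: "narr s ''q'' = q" "rarr s ''z'' = z" "rarr s ''c'' = c"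
      "ready n D q c z \<alpha> K C s" "loop_frame n D q c z \<alpha> K C P a b s"
      using frame[of s] by (simp_all add: I_def)
    have sel: "bval selection_test s = S k"
      using bval_selection_test[OF fr(4)] I k by (simp add: I_def S_def)
    have "W (Suc k) = W k + (if S k then 0 else max (height S z q k (q k)) (z k) - height S z q k (q k))"
      unfolding W_def by (rule sum_height_Suc[OF k])
    moreover have "q k \<in> q ` {..<n}" using k by simp
    moreover note I sel
    ultimately show "wpt (Cond selection_test
        (RAssign ''cost'' (RAdd (RVar ''cost'') (RArr ''c'' (NVar ''i''))))
        (Cond (RLess (RArr ''h'' (NArr ''q'' (NVar ''i''))) vertex_value)
           (Seq (RAssign ''hs'' (RAdd (RVar ''hs'')
                   (RSub vertex_value (RArr ''h'' (NArr ''q'' (NVar ''i''))))))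
              (RStore ''h'' (NArr ''q'' (NVar ''i'')) vertex_value))
           Skip)) s
        (\<lambda>t s'. t \<le> 250 \<and> nvar s' ''i'' = k \<and> I (Suc k) (s'\<lparr>nvar := (nvar s')(''i'' := Suc k)\<rparr>))"
      using fr btime_selection_test
      by (auto simp: I_def loop_frame_update max_def)
  qed (use F rv frame in \<open>auto simp: I_def W_def loop_frame_update\<close>)
  then show ?thesis
    by (rule wpt_mono) (auto simp: I_def S_def W_def choice_cost_def total_height_def)
qed

lemma wpt_try_pair:
  assumes F: "loop_frame n D q c z \<alpha> K C P a b s"
  shows "wpt try_pair s (\<lambda>t s'. t \<le> 400 * (n + 1) \<and>
     loop_frame n D q c z \<alpha> K C (insert (C a, C b) P) a b s')"
proof -
  define s1 where "s1 = s\<lparr>rvar := (rvar s)(''u'' := C a, ''v'' := C b, ''cost'' := 0, ''hs'' := 0)\<rparr>"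
  have F1: "loop_frame n D q c z \<alpha> K C P a b s1"
    using F by (simp add: s1_def loop_frame_update)
  have clear: "wpt clear_heights s1 (\<lambda>t s'. t \<le> 2 + (n + 1) * 20 \<and> loop_frame n D q c z \<alpha> K C P a b s' \<and>
     rvar s' ''u'' = C a \<and> rvar s' ''v'' = C b \<and> rvar s' ''cost'' = 0 \<and> rvar s' ''hs'' = 0 \<and>
     (\<forall>j\<in>q ` {..<n}. rarr s' ''h'' j = 0))"
    by (rule wpt_clear_heights[OF F1]) (simp_all add: s1_def)
  have ab: "rarr s ''cand'' = C" "nvar s ''a'' = a" "nvar s ''b'' = b"
    using F by (auto simp: loop_frame_def ready_def)
  have update: "wpt update_best s' (\<lambda>t s''. t \<le> 40 \<and>
      loop_frame n D q c z \<alpha> K C (insert (C a, C b) P) a b s'')"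
    if "loop_frame n D q c z \<alpha> K C P a b s'" "rvar s' ''u'' = C a" "rvar s' ''v'' = C b"
      "rvar s' ''cost'' = choice_cost n D q c z (C a) (C b)"
      "rvar s' ''hs'' = total_height n D q z (C a) (C b)" for s'
    using that unfolding update_best_def
    by (auto simp: loop_frame_def ready_def incumbent_def split: if_splits)
  have "wpt (Seq clear_heights (Seq accumulate (Seq update_best Skip))) s1
     (\<lambda>t s'. t \<le> 50 + (n + 1) * 320 \<and> loop_frame n D q c z \<alpha> K C (insert (C a, C b) P) a b s')"
    unfolding wpt_simps
    by (rule wpt_mono[OF clear], elim conjE, rule wpt_mono[OF wpt_accumulate], assumption+, elim conjE,
        rule wpt_mono[OF update], assumption+) auto
  then show ?thesis unfolding try_pair_def block.simps
    by (simp add: ab s1_def[symmetric]) (auto elim!: wpt_mono)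
qed

definition search :: com where
  "search = Seq (NAssign ''found'' (NConst 0))
     (for_com ''a'' (NVar ''k'') (for_com ''b'' (NVar ''k'') try_pair))"

lemma wpt_search:
  assumes F: "ready n D q c z \<alpha> K C s"
  shows "wpt search s (\<lambda>t s'. t \<le> 4 + (K + 1) * (10 + (K + 1) * (8 + 400 * (n + 1))) \<and>
     ready n D q c z \<alpha> K C s' \<and> incumbent n D q c z \<alpha> (C ` {..<K} \<times> C ` {..<K}) s')"
proof -
  \<comment> \<open>Between rows \<open>b\<close> holds a leftover of the inner loop, hence the
    existential quantifier.\<close>
  define I where "I k s \<longleftrightarrow> (\<exists>b. loop_frame n D q c z \<alpha> K C (C ` {..<k} \<times> C ` {..<K}) k b s)"
    for k and s :: state
  define J where "J k l s \<longleftrightarrow>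
     loop_frame n D q c z \<alpha> K C (C ` {..<k} \<times> C ` {..<K} \<union> {C k} \<times> C ` {..<l}) k l s"
    for k l and s :: state
  have inner: "wpt (for_com ''b'' (NVar ''k'') try_pair) s
      (\<lambda>t s'. t \<le> 2 + (K + 1) * (7 + ntime (NVar ''k'') + 400 * (n + 1)) \<and> J k K s')"
    if I: "I k s" for k s
  proof (rule wpt_for_com[where I = "J k"])
    show "J k 0 (s\<lparr>nvar := (nvar s)(''b'' := 0)\<rparr>)"
      using I by (auto simp: I_def J_def loop_frame_def ready_def incumbent_def)
  next
    fix l s assume "J k l s"
    then have "loop_frame n D q c z \<alpha> K C (C ` {..<k} \<times> C ` {..<K} \<union> {C k} \<times> C ` {..<l}) k l s"
      by (simp add: J_def)
    moreover have "insert (C k, C l) (C ` {..<k} \<times> C ` {..<K} \<union> {C k} \<times> C ` {..<l})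
        = C ` {..<k} \<times> C ` {..<K} \<union> {C k} \<times> C ` {..<Suc l}"
      by (auto simp: lessThan_Suc)
    ultimately have "wpt try_pair s (\<lambda>t s'. t \<le> 400 * (n + 1) \<and> loop_frame n D q c z \<alpha> K C
        (C ` {..<k} \<times> C ` {..<K} \<union> {C k} \<times> C ` {..<Suc l}) k l s')"
      using wpt_try_pair by metis
    then show "wpt try_pair s (\<lambda>t s'. t \<le> 400 * (n + 1) \<and> nvar s' ''b'' = l \<and>
        J k (Suc l) (s'\<lparr>nvar := (nvar s')(''b'' := Suc l)\<rparr>))"
      by (rule wpt_mono) (simp add: J_def loop_frame_def ready_def)
  qed (auto simp: J_def loop_frame_def ready_def)
  have "wpt (for_com ''a'' (NVar ''k'') (for_com ''b'' (NVar ''k'') try_pair))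
      (s\<lparr>nvar := (nvar s)(''found'' := 0)\<rparr>) (\<lambda>t s'. t \<le> 2 + (K + 1) * (7 + ntime (NVar ''k'') +
      (2 + (K + 1) * (7 + ntime (NVar ''k'') + 400 * (n + 1)))) \<and> I K s')"
  proof (rule wpt_for_com[where I = I])
    show "I 0 (s\<lparr>nvar := (nvar s)(''found'' := 0)\<rparr>\<lparr>nvar := (nvar (s\<lparr>nvar := (nvar s)(''found'' := 0)\<rparr>))(''a'' := 0)\<rparr>)"
      using F by (auto simp: I_def loop_frame_def ready_def incumbent_def)
  next
    fix k s assume "I k s"
    have step: "C ` {..<k} \<times> C ` {..<K} \<union> {C k} \<times> C ` {..<K} = C ` {..<Suc k} \<times> C ` {..<K}"
      by (auto simp: lessThan_Suc)
    from inner[OF \<open>I k s\<close>] show "wpt (for_com ''b'' (NVar ''k'') try_pair) s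
       (\<lambda>t s'. t \<le> 2 + (K + 1) * (7 + ntime (NVar ''k'') + 400 * (n + 1)) \<and> nvar s' ''a'' = k \<and>
          I (Suc k) (s'\<lparr>nvar := (nvar s')(''a'' := Suc k)\<rparr>))"
      by (elim wpt_mono) (simp add: I_def J_def step loop_frame_def ready_def)
  qed (auto simp: I_def loop_frame_def ready_def)
  then show ?thesis unfolding search_def by (auto simp: I_def loop_frame_def elim!: wpt_mono)
qed

definition write_output :: com where
  "write_output = block [
     RAssign ''u'' (RVar ''bu''), RAssign ''v'' (RVar ''bv''),
     for_com ''i'' (NVar ''n'')
       (Cond selection_test (NStore ''xbar'' (NVar ''i'') (NConst 1))
          (NStore ''xbar'' (NVar ''i'') (NConst 0)))]"

lemma wpt_write_output:
  assumes R: "ready n D q c z \<alpha> K C s" and uv: "rvar s ''bu'' = u" "rvar s ''bv'' = v"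
  shows "wpt write_output s (\<lambda>t s'. t \<le> 10 + (n + 1) * 230 \<and>
     (\<forall>i<n. narr s' ''xbar'' i = (if chosen D q z u v i then 1 else 0)))"
proof -
  define I where "I k s \<longleftrightarrow> ready n D q c z \<alpha> K C s \<and> nvar s ''i'' = k \<and>
     rvar s ''u'' = u \<and> rvar s ''v'' = v \<and>
     (\<forall>i<k. narr s ''xbar'' i = (if chosen D q z u v i then 1 else 0))" for k and s :: state
  have loop: "wpt (for_com ''i'' (NVar ''n'')
       (Cond selection_test (NStore ''xbar'' (NVar ''i'') (NConst 1))
          (NStore ''xbar'' (NVar ''i'') (NConst 0)))) s
     (\<lambda>t s'. t \<le> 2 + (n + 1) * (7 + ntime (NVar ''n'') + 220) \<and> I n s')"
    if I0: "I 0 (s\<lparr>nvar := (nvar s)(''i'' := 0)\<rparr>)" for s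
  proof (rule wpt_for_com[where I = I, OF I0])
    fix k s assume k: "k < n" and I: "I k s"
    have "bval selection_test s = chosen D q z u v k"
      using bval_selection_test[of n D q c z \<alpha> K C s] I k by (simp add: I_def)
    then show "wpt (Cond selection_test (NStore ''xbar'' (NVar ''i'') (NConst 1))
          (NStore ''xbar'' (NVar ''i'') (NConst 0))) s
       (\<lambda>t s'. t \<le> 220 \<and> nvar s' ''i'' = k \<and> I (Suc k) (s'\<lparr>nvar := (nvar s')(''i'' := Suc k)\<rparr>))"
      using I btime_selection_test by (auto simp: I_def ready_def less_Suc_eq)
  qed (auto simp: I_def ready_def)
  show ?thesis unfolding write_output_def block.simps wpt_simps
    by (rule wpt_mono[OF loop]) (use R uv in \<open>auto simp: I_def ready_def\<close>)
qed

section \<open>Assembling the phases and their time bounds\<close>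

lemma wpt_Seq_bounded:
  assumes "wpt p s (\<lambda>t s'. t \<le> a \<and> P s')" "\<And>s'. P s' \<Longrightarrow> wpt q s' (\<lambda>t s''. t \<le> b \<and> Q s'')"
  shows "wpt (Seq p q) s (\<lambda>t s''. t \<le> a + b \<and> Q s'')"
  unfolding wpt_simps
  by (rule wpt_mono[OF assms(1)], elim conjE, rule wpt_mono[OF assms(2)]) auto

definition round_cover :: com where
  "round_cover = Seq label_parts (Seq assign_roles (Seq scale_and_breakpoints (Seq search write_output)))"

text \<open>One summand per phase. The cubic term comes from the search: quadratically many
  candidate pairs at linear cost each.\<close>

definition round_cover_time :: "nat \<Rightarrow> nat" where
  "round_cover_time n = (2 + (n + 1) * 40) + ((60 + (n + 2) * 30) + ((60 + (n + 1) * 110) +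
     ((4 + (2 + 6 * n + 1) * (10 + (2 + 6 * n + 1) * (8 + 400 * (n + 1)))) + (10 + (n + 1) * 230))))"

lemma round_cover_time_bigo: "(\<lambda>n. real (10 + round_cover_time n)) \<in> O(\<lambda>n. real n ^ 3)"
  unfolding round_cover_time_def of_nat_add of_nat_mult of_nat_numeral of_nat_1 by real_asymp

lemma wpt_round_cover:
  fixes n :: nat and p :: "nat \<Rightarrow> nat" and c x :: "nat \<Rightarrow> real"
  defines "m \<equiv> card (p ` {..<n})"
  defines "D \<equiv> max 4 m"
  defines "\<alpha> \<equiv> real D / 2 - real D / (128 * real n)"
  assumes s: "nvar s ''n'' = n" "nvar s ''m'' = 0" "narr s ''part'' = p"
    "narr s ''lab'' = (\<lambda>_. 0)" "rarr s ''c'' = c" "rarr s ''x'' = x" "rarr s ''cand'' = (\<lambda>_. 0)"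
    and n: "0 < n" and c: "\<And>i. i < n \<Longrightarrow> 0 \<le> c i" and x: "\<And>i. i < n \<Longrightarrow> 0 \<le> x i"
  shows "wpt round_cover s (\<lambda>t s'. t \<le> round_cover_time n \<and>
    (\<exists>q z u v. (\<forall>i<n. \<forall>j<n. q i = q j \<longrightarrow> p i = p j) \<and> (\<forall>i<n. z i = \<alpha> * x i) \<and>
       total_height n D q z u v < \<alpha> \<and> choice_cost n D q c z u v \<le> (\<Sum>i<n. c i * z i) \<and>
       (\<forall>i<n. narr s' ''xbar'' i = (if chosen D q z u v i then 1 else 0))))"
    (is "wpt _ _ (\<lambda>t s'. _ \<and> ?Post s')")
proof -
  have m: "m \<le> n" unfolding m_def using card_image_le[of "{..<n}" p] by simp
  have D: "4 \<le> D" "D \<le> 4 * n" using m n unfolding D_def by auto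
  have "real D / (128 * real n) \<le> real D / 2" using n by (intro divide_left_mono) auto
  then have \<alpha>: "0 \<le> \<alpha>" unfolding \<alpha>_def by simp
  \<comment> \<open>\<open>A1\<close> to \<open>A4\<close> are the assertions between consecutive
    phases.\<close>
  define A1 where "A1 s' \<longleftrightarrow> nvar s' ''n'' = n \<and> rarr s' = rarr s \<and> nvar s' ''m'' = m \<and>
     (\<exists>lab. bij_betw lab (p ` {..<n}) {1..m} \<and> (\<forall>i<n. narr s' ''q'' i = lab (p i)))" for s' :: state
  define good where "good q \<longleftrightarrow> q ` {..<n} \<subseteq> {1..m} \<and> (\<forall>i<n. \<forall>j<n. q i = q j \<longrightarrow> p i = p j)"
    for q :: "nat \<Rightarrow> nat"
  define A2 where "A2 s' \<longleftrightarrow> nvar s' ''n'' = n \<and> good (narr s' ''q'') \<and> rarr s' = rarr s \<and>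
     nvar s' ''D'' = D \<and> (\<forall>j\<in>{1..m}. narr s' ''R'' j = role D j)" for s' :: state
  define A3 where "A3 s' \<longleftrightarrow> (\<exists>q z C. good q \<and> ready n D q c z \<alpha> (2 + 6 * n) C s' \<and>
     (\<forall>i<n. z i = \<alpha> * x i) \<and>
     {0, 1/2} \<union> (\<Union>i<n. breakpoints (z i)) \<subseteq> C ` {..<2 + 6 * n})" for s' :: state
  define A4 where "A4 s' \<longleftrightarrow> (\<exists>q z C u v. good q \<and> ready n D q c z \<alpha> (2 + 6 * n) C s' \<and>
     (\<forall>i<n. z i = \<alpha> * x i) \<and> rvar s' ''bu'' = u \<and> rvar s' ''bv'' = v \<and>
     total_height n D q z u v < \<alpha> \<and> choice_cost n D q c z u v \<le> (\<Sum>i<n. c i * z i))" for s' :: state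
  have 1: "wpt label_parts s (\<lambda>t s'. t \<le> 2 + (n + 1) * 40 \<and> A1 s')"
    using wpt_label_parts[OF s(1-4) refl] unfolding A1_def m_def by simp
  have 2: "wpt assign_roles s' (\<lambda>t s'. t \<le> 60 + (n + 2) * 30 \<and> A2 s')" if A: "A1 s'" for s'
  proof -
    obtain lab where lab: "bij_betw lab (p ` {..<n}) {1..m}" "\<forall>i<n. narr s' ''q'' i = lab (p i)"
      using A unfolding A1_def by blast
    have "good (narr s' ''q'')"
      using lab unfolding good_def bij_betw_def inj_on_def by auto
    moreover have "nvar s' ''n'' = n" "nvar s' ''m'' = m" "rarr s' = rarr s"
      using A by (simp_all add: A1_def)
    note wpt_assign_roles[OF this(1,2) refl this(3), folded D_def]
    ultimately show ?thesis using m by (elim wpt_mono) (simp add: A2_def)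
  qed
  have 3: "wpt scale_and_breakpoints s' (\<lambda>t s'. t \<le> 60 + (n + 1) * 110 \<and> A3 s')" if A: "A2 s'" for s'
  proof -
    have good: "good (narr s' ''q'')" using A by (simp add: A2_def)
    have "narr s' ''q'' i \<in> {1..m}" if "i < n" for i using good that unfolding good_def by blast
    then have "narr s' ''R'' (narr s' ''q'' i) = role D (narr s' ''q'' i)" if "i < n" for i
      using A that unfolding A2_def by blast
    then have "wpt scale_and_breakpoints s' (\<lambda>t s''. t \<le> 60 + (n + 1) * 110 \<and>
     (\<exists>z C. ready n D (narr s' ''q'') c z \<alpha> (2 + 6 * n) C s'' \<and> (\<forall>i<n. z i = \<alpha> * x i) \<and>
        {0, 1/2} \<union> (\<Union>i<n. breakpoints (z i)) \<subseteq> C ` {..<2 + 6 * n}))"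
      using A s unfolding A2_def by (intro wpt_scale_and_breakpoints) (simp_all add: \<alpha>_def)
    then show ?thesis
    proof (rule wpt_mono, elim conjE, intro conjI)
      fix t s''
      assume "\<exists>z C. ready n D (narr s' ''q'') c z \<alpha> (2 + 6 * n) C s'' \<and> (\<forall>i<n. z i = \<alpha> * x i) \<and>
        {0, 1/2} \<union> (\<Union>i<n. breakpoints (z i)) \<subseteq> C ` {..<2 + 6 * n}"
      with good show "A3 s''" unfolding A3_def by blast
    qed
  qed
  have 4: "wpt search s' (\<lambda>t s'. t \<le> 4 + (2 + 6 * n + 1) * (10 + (2 + 6 * n + 1) * (8 + 400 * (n + 1))) \<and> A4 s')"
    if A: "A3 s'" for s'
  proof -
    obtain q z C where q: "good q" and r: "ready n D q c z \<alpha> (2 + 6 * n) C s'"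
      and z: "\<forall>i<n. z i = \<alpha> * x i"
      and C: "{0, 1/2} \<union> (\<Union>i<n. breakpoints (z i)) \<subseteq> C ` {..<2 + 6 * n}"
      using A unfolding A3_def by blast
    have "{1..m} \<subseteq> {1..D}" unfolding D_def by auto
    then have "q ` {..<n} \<subseteq> {1..D}" using q unfolding good_def by blast
    moreover have "\<And>i. i < n \<Longrightarrow> 0 \<le> z i" using z x \<alpha> by simp
    ultimately have "\<exists>u\<in>C ` {..<2 + 6 * n}. \<exists>v\<in>C ` {..<2 + 6 * n}.
        total_height n D q z u v < \<alpha> \<and> choice_cost n D q c z u v \<le> (\<Sum>i<n. c i * z i)"
      unfolding \<alpha>_def using c C by (intro cheap_breakpoints_exist[OF D]) simp_all
    then obtain u v where uv: "(u, v) \<in> C ` {..<2 + 6 * n} \<times> C ` {..<2 + 6 * n}"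
      "total_height n D q z u v < \<alpha>" "choice_cost n D q c z u v \<le> (\<Sum>i<n. c i * z i)"
      by blast
    show ?thesis
    proof (rule wpt_mono[OF wpt_search[OF r]], elim conjE, intro conjI)
      fix s'' assume r': "ready n D q c z \<alpha> (2 + 6 * n) C s''"
        and inc: "incumbent n D q c z \<alpha> (C ` {..<2 + 6 * n} \<times> C ` {..<2 + 6 * n}) s''"
      \<comment> \<open>The pair from \<open>cheap_breakpoints_exist\<close> is among those tried,
        so the search cannot come back empty-handed.\<close>
      have "nvar s'' ''found'' \<noteq> 0"
      proof
        assume "nvar s'' ''found'' = 0"
        with inc have "\<forall>(u, v)\<in>C ` {..<2 + 6 * n} \<times> C ` {..<2 + 6 * n}. \<not> total_height n D q z u v < \<alpha>"
          unfolding incumbent_def by presburger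
        then show False using uv(1,2) by blast
      qed
      note * = inc[unfolded incumbent_def if_not_P[OF this]]
      have "total_height n D q z (rvar s'' ''bu'') (rvar s'' ''bv'') < \<alpha>" using * by blast
      moreover have "rvar s'' ''best'' \<le> choice_cost n D q c z u v" using * uv(1,2) by blast
      then have "choice_cost n D q c z (rvar s'' ''bu'') (rvar s'' ''bv'') \<le> (\<Sum>i<n. c i * z i)"
        using * uv(3) by linarith
      ultimately show "A4 s''" using r' q z unfolding A4_def by blast
    qed simp
  qed
  have 5: "wpt write_output s' (\<lambda>t s'. t \<le> 10 + (n + 1) * 230 \<and> ?Post s')" if A: "A4 s'" for s'
  proof -
    obtain q z C u v where q: "good q" and r: "ready n D q c z \<alpha> (2 + 6 * n) C s'"
        "rvar s' ''bu'' = u" "rvar s' ''bv'' = v"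
      and *: "\<forall>i<n. z i = \<alpha> * x i" "total_height n D q z u v < \<alpha>"
        "choice_cost n D q c z u v \<le> (\<Sum>i<n. c i * z i)"
      using A unfolding A4_def by blast
    show ?thesis
      by (rule wpt_mono[OF wpt_write_output[OF r]])
        (use q * in \<open>unfold good_def, blast\<close>)
  qed
  show ?thesis unfolding round_cover_def round_cover_time_def
    by (rule wpt_Seq_bounded[OF 1 wpt_Seq_bounded[OF 2 wpt_Seq_bounded[OF 3 wpt_Seq_bounded[OF 4 5]]]])
qed

section \<open>From selected indices to vertex covers\<close>

lemma sum_unchosen_le_total_height:
  assumes I: "I \<subseteq> {..<n}" "inj_on q I" "\<And>i. i \<in> I \<Longrightarrow> \<not> chosen D q z u v i"
  shows "sum z I \<le> total_height n D q z u v"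
proof -
  let ?h = "height (chosen D q z u v) z q n"
  \<comment> \<open>An unselected value is at most the height of its label, and injectivity charges
    every label at most once.\<close>
  have "sum z I \<le> (\<Sum>i\<in>I. ?h (q i))"
    using I(1,3) by (intro sum_mono height_ge) auto
  also have "\<dots> = sum ?h (q ` I)" using I(2) by (simp add: sum.reindex)
  also have "\<dots> \<le> total_height n D q z u v"
    unfolding total_height_def using I(1) by (intro sum_mono2) (auto simp: height_nonneg)
  finally show ?thesis .
qed

lemma part_index_props:
  assumes "d_partition V B d Vs" "v \<in> V"
  shows "part_index d Vs v \<in> {1..d}" "v \<in> Vs (part_index d Vs v)"
proof -
  have "\<exists>!j. j \<in> {1..d} \<and> v \<in> Vs j"
    using assms unfolding d_partition_def disjoint_family_on_def by blast
  from theI'[OF this] show "part_index d Vs v \<in> {1..d}" "v \<in> Vs (part_index d Vs v)"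
    unfolding part_index_def by blast+
qed

text \<open>An edge without selected vertices would have pairwise different labels, so its z-values
  would sum to at most the total height, which is below \<alpha>; but z = \<alpha> x and the edge
  has x-weight at least 1.\<close>

lemma round_cover_correct:
  fixes V :: "'a set" and c x :: "'a \<Rightarrow> real"
  assumes d: "4 \<le> d" and H: "hypergraph V B" and part: "d_partition V B d Vs"
    and vs: "distinct vs" "set vs = V" and ne: "vs \<noteq> []"
    and c: "\<forall>v\<in>V. 0 \<le> c v" and x: "fractional_vertex_cover V B x"
  shows "\<exists>t s xbar. exec round_cover (input_state vs d Vs c x) t s \<and> t \<le> round_cover_time (card V) \<and>
    output_vector vs s xbar \<and> integral_vertex_cover V B xbar \<and>
    (\<Sum>v\<in>V. c v * xbar v)
      \<le> (real d / 2 - real d / (128 * real (card V))) * (\<Sum>v\<in>V. c v * x v)"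
proof -
  define n where "n = length vs"
  have n: "0 < n" "card V = n" using ne vs distinct_card unfolding n_def by fastforce+
  define p where "p = input_array vs (part_index d Vs)"
  define cc xx where "cc = input_array vs c" and "xx = input_array vs x"
  have nth: "vs ! i \<in> V" "p i = part_index d Vs (vs ! i)" "cc i = c (vs ! i)" "xx i = x (vs ! i)"
    if "i < n" for i
    using that vs by (auto simp: n_def p_def cc_def xx_def input_array_def)
  have bij: "bij_betw (\<lambda>i. vs ! i) {..<n} V"
    using bij_betw_nth[OF vs(1)] vs(2) by (simp add: n_def)
  define D where "D = max 4 (card (p ` {..<n}))"
  define \<alpha> where "\<alpha> = real D / 2 - real D / (128 * real n)"
  have "p ` {..<n} \<subseteq> {1..d}" using nth part_index_props(1)[OF part] by auto
  then have "card (p ` {..<n}) \<le> d" using card_mono[of "{1..d}"] by fastforce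
  then have D: "4 \<le> D" "D \<le> d" using d by (auto simp: D_def)
  \<comment> \<open>The ratio is k times a positive constant, hence monotone in k; this passes from
    D to d.\<close>
  have factor: "real k / 2 - real k / (128 * real n) = real k * (1/2 - 1 / (128 * real n))" for k
    by (simp add: algebra_simps)
  have frac: "1 / (128 * real n) < 1/2" using n by (simp add: field_simps)
  have \<alpha>: "0 < \<alpha>" "\<alpha> \<le> real d / 2 - real d / (128 * real n)"
    unfolding \<alpha>_def factor using D frac by (auto intro!: mult_right_mono)
  have x0: "0 \<le> x v" if "v \<in> V" for v using x that by (simp add: fractional_vertex_cover_def)
  have "wpt round_cover (input_state vs d Vs c x) (\<lambda>t s'. t \<le> round_cover_time n \<and>
    (\<exists>q z u v. (\<forall>i<n. \<forall>j<n. q i = q j \<longrightarrow> p i = p j) \<and> (\<forall>i<n. z i = \<alpha> * xx i) \<and>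
       total_height n D q z u v < \<alpha> \<and> choice_cost n D q cc z u v \<le> (\<Sum>i<n. cc i * z i) \<and>
       (\<forall>i<n. narr s' ''xbar'' i = (if chosen D q z u v i then 1 else 0))))"
    unfolding D_def \<alpha>_def
    by (rule wpt_round_cover)
      (use n nth c x0 in \<open>auto simp: input_state_def n_def p_def cc_def xx_def\<close>)
  then obtain t s q z u v where ex: "exec round_cover (input_state vs d Vs c x) t s"
      "t \<le> round_cover_time n"
    and q: "\<forall>i<n. \<forall>j<n. q i = q j \<longrightarrow> p i = p j" and z: "\<forall>i<n. z i = \<alpha> * xx i"
    and low: "total_height n D q z u v < \<alpha>"
    and cost: "choice_cost n D q cc z u v \<le> (\<Sum>i<n. cc i * z i)"
    and out: "\<forall>i<n. narr s ''xbar'' i = (if chosen D q z u v i then 1 else 0)"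
    unfolding wpt_def by blast
  define xbar where "xbar w = real (narr s ''xbar'' (inv_into {..<n} ((!) vs) w))" for w
  have xbar: "xbar (vs ! i) = (if chosen D q z u v i then 1 else 0)"
      "xbar (vs ! i) = real (narr s ''xbar'' i)" if "i < n" for i
    using bij_betw_inv_into_left[OF bij] that out by (auto simp: xbar_def)
  have idx: "\<exists>i<n. w = vs ! i" if "w \<in> V" for w
    using that vs unfolding n_def by (metis in_set_conv_nth)
  have "integral_vertex_cover V B xbar"
    unfolding integral_vertex_cover_def
  proof (intro conjI ballI)
    show "xbar w \<in> {0, 1}" if "w \<in> V" for w using idx[OF that] xbar by auto
    fix P assume P: "P \<in> B"
    then have PV: "P \<subseteq> V" "finite P" using H finite_subset unfolding hypergraph_def by blast+
    show "1 \<le> sum xbar P"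
    proof (cases "\<exists>w\<in>P. xbar w = 1")
      case True
      then obtain w where w: "w \<in> P" "xbar w = 1" by blast
      then show ?thesis using member_le_sum[of w P xbar] PV by (simp add: xbar_def)
    next
      case False
      define I where "I = {i. i < n \<and> vs ! i \<in> P}"
      have I: "I \<subseteq> {..<n}" by (auto simp: I_def)
      have inj: "inj_on (\<lambda>i. vs ! i) I" using bij I unfolding bij_betw_def by (rule inj_on_subset[OF conjunct1])
      have PI: "P = (\<lambda>i. vs ! i) ` I" using idx PV by (auto simp: I_def)
      have "inj_on q I"
      proof (rule inj_onI)
        fix i j assume ij: "i \<in> I" "j \<in> I" "q i = q j"
        then have "p i = p j" using q by (auto simp: I_def)
        then have "vs ! i \<in> P \<inter> Vs (p i)" "vs ! j \<in> P \<inter> Vs (p i)" "p i \<in> {1..d}"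
          using ij nth part_index_props[OF part] by (auto simp: I_def) metis+
        moreover have "card (P \<inter> Vs (p i)) \<le> Suc 0"
          using part P calculation(3) unfolding d_partition_def by auto
        ultimately have "vs ! i = vs ! j" using PV by (meson card_le_Suc0_iff_eq finite_Int)
        then show "i = j" using inj ij by (auto dest: inj_onD)
      qed
      moreover have "\<not> chosen D q z u v i" if "i \<in> I" for i
        using False xbar(1)[of i] that by (auto simp: I_def)
      ultimately have "sum z I \<le> total_height n D q z u v"
        using sum_unchosen_le_total_height I by metis
      moreover have "sum z I = \<alpha> * sum x P"
        unfolding PI sum.reindex[OF inj] using z nth
        by (simp add: sum_distrib_left I_def)
      moreover have "1 \<le> sum x P" using x P by (simp add: fractional_vertex_cover_def)
      then have "\<alpha> * 1 \<le> \<alpha> * sum x P" using \<alpha>(1) by (intro mult_left_mono) auto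
      ultimately show ?thesis using low by linarith
    qed
  qed
  moreover have "(\<Sum>v\<in>V. c v * xbar v)
      \<le> (real d / 2 - real d / (128 * real (card V))) * (\<Sum>v\<in>V. c v * x v)"
  proof -
    have "(\<Sum>v\<in>V. c v * xbar v) = choice_cost n D q cc z u v"
      unfolding choice_cost_def sum.reindex_bij_betw[OF bij, symmetric]
      using xbar nth by (intro sum.cong) auto
    also have "\<dots> \<le> (\<Sum>i<n. cc i * z i)" by (rule cost)
    also have "\<dots> = \<alpha> * (\<Sum>v\<in>V. c v * x v)"
      unfolding sum.reindex_bij_betw[OF bij, symmetric] sum_distrib_left
      using z nth by (intro sum.cong) auto
    also have "\<dots> \<le> (real d / 2 - real d / (128 * real n)) * (\<Sum>v\<in>V. c v * x v)"
      using \<alpha>(2) c x0 by (intro mult_right_mono sum_nonneg) auto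
    finally show ?thesis using n(2) by simp
  qed
  moreover have "output_vector vs s xbar"
    using xbar(2) by (simp add: output_vector_def n_def)
  ultimately show ?thesis using ex n(2) by blast
qed

theorem theorem14:
  "\<exists>(prog :: com) (T :: nat \<Rightarrow> nat).
     (\<lambda>n. real (T n)) \<in> O(\<lambda>n. real n ^ 3) \<and>
     (\<forall>(d :: nat) (V :: 'a set) (B :: 'a set set) (Vs :: nat \<Rightarrow> 'a set) (vs :: 'a list)
        (c :: 'a \<Rightarrow> real) (x :: 'a \<Rightarrow> real).
        d \<ge> 4 \<longrightarrow> hypergraph V B \<longrightarrow> d_partition V B d Vs \<longrightarrow>
        distinct vs \<longrightarrow> set vs = V \<longrightarrow>
        (\<forall>v\<in>V. 0 \<le> c v) \<longrightarrow> fractional_vertex_cover V B x \<longrightarrow>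
        (\<exists>t s xbar.
           exec prog (input_state vs d Vs c x) t s \<and> t \<le> T (card V) \<and>
           output_vector vs s xbar \<and>
           integral_vertex_cover V B xbar \<and>
           (\<Sum>v\<in>V. c v * xbar v)
             \<le> (real d / 2 - real d / (128 * real (card V))) * (\<Sum>v\<in>V. c v * x v)))"
proof (rule exI[of _ "Cond (NEq (NVar ''n'') (NConst 0)) Skip round_cover"],
    rule exI[of _ "\<lambda>n. 10 + round_cover_time n"], intro conjI allI impI)
  show "(\<lambda>n. real (10 + round_cover_time n)) \<in> O(\<lambda>n. real n ^ 3)"
    by (rule round_cover_time_bigo)
next
  fix d :: nat and V :: "'a set" and B Vs vs and c x :: "'a \<Rightarrow> real"
  assume *: "4 \<le> d" "hypergraph V B" "d_partition V B d Vs" "distinct vs" "set vs = V"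
    "\<forall>v\<in>V. 0 \<le> c v" "fractional_vertex_cover V B x"
  \<comment> \<open>The case n = 0 is caught first because the analysis of
    \<open>round_cover\<close> rests on D \<le> 4n.\<close>
  let ?prog = "Cond (NEq (NVar ''n'') (NConst 0)) Skip round_cover"
  let ?s = "input_state vs d Vs c x"
  show "\<exists>t s xbar. exec ?prog ?s t s \<and> t \<le> 10 + round_cover_time (card V) \<and>
      output_vector vs s xbar \<and> integral_vertex_cover V B xbar \<and>
      (\<Sum>v\<in>V. c v * xbar v)
        \<le> (real d / 2 - real d / (128 * real (card V))) * (\<Sum>v\<in>V. c v * x v)"
  proof (cases "vs = []")
    case True
    \<comment> \<open>The only conceivable edge is the empty set, and its covering constraint 0
      \<ge> 1 is violated.\<close>
    then have "V = {}" "B = {}"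
      using * by (force simp: hypergraph_def fractional_vertex_cover_def)+
    then have rest: "output_vector vs ?s (\<lambda>_. 0)" "integral_vertex_cover V B (\<lambda>_. 0)"
      "(\<Sum>v\<in>V. c v * 0)
        \<le> (real d / 2 - real d / (128 * real (card V))) * (\<Sum>v\<in>V. c v * x v)"
      using True by (auto simp: output_vector_def integral_vertex_cover_def)
    have "bval (NEq (NVar ''n'') (NConst 0)) ?s" using True by (simp add: input_state_def)
    note run = CondTrue[OF this Skip]
    have "1 + btime (NEq (NVar ''n'') (NConst 0)) + 1 \<le> 10 + round_cover_time (card V)" by simp
    with run rest show ?thesis by blast
  next
    case False
    then have "\<not> bval (NEq (NVar ''n'') (NConst 0)) ?s" by (simp add: input_state_def)
    note run = CondFalse[OF this]
    obtain t s xbar where r: "exec round_cover ?s t s" "t \<le> round_cover_time (card V)"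
      and rest: "output_vector vs s xbar" "integral_vertex_cover V B xbar"
        "(\<Sum>v\<in>V. c v * xbar v)
          \<le> (real d / 2 - real d / (128 * real (card V))) * (\<Sum>v\<in>V. c v * x v)"
      using round_cover_correct[OF *(1-5) False *(6,7)] by blast
    have "1 + btime (NEq (NVar ''n'') (NConst 0)) + t \<le> 10 + round_cover_time (card V)"
      using r(2) by simp
    with run[OF r(1)] rest show ?thesis by blast
  qed
qed

end
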